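(* Let $\pi=(d_1,\dots,d_n)$ be the degree sequence of a tree with $d_1\ge\cdots\ge d_k\ge 2$ and $d_{k+1}=\cdots=d_n=1$ (so exactly $n-k$ leaves), where $2\le k\le 4$. Then: (i) If $k=2$, then $\varphi(T)=2^{n-2}+2^{d_1-1}+2^{d_2-1}+n-2$ for every $T\in\mathcal{T}_\pi$. (ii) If $k=3$, then for every $T\in\mathcal{T}_\pi$, $$\varphi(T)\ge\varphi(C(d_1-2,d_3-2,d_2-2))=n-3+2^{d_1-1}+2^{d_2-1}+2^{d_3-2}+2^{d_1+d_3-3}+2^{d_3+d_2-3}+2^{n-3},$$ with equality if and only if $T$ is (isomorphic to) the caterpillar $C(d_1-2,d_3-2,d_2-2)$. (iii) If $k=4$, then for every $T\in\mathcal{T}_\pi$, $$\varphi(T)\ge\varphi(C(d_1-2,d_4-2,d_3-2,d_2-2))=n-4+2^{d_1-1}+2^{d_2-1}+2^{d_3-2}+2^{d_4-2}+2^{d_1+d_4-3}+2^{d_3+d_4-4}+2^{d_3+d_2-3}+2^{d_1+d_4+d_3-5}+2^{d_2+d_3+d_4-5}+2^{n-4},$$ with equality if and only if $T$ is (isomorphic to) the caterpillar $C(d_1-2,d_4-2,d_3-2,d_2-2)$.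
   Context: A subtree of a tree is a nonempty connected subgraph; $\varphi(T)$ is the number of nonempty subtrees of $T$. $\mathcal{T}_\pi$ is the set of all trees with degree sequence $\pi$. For a permutation $(y_1,\dots,y_k)$ of $(d_1-2,\dots,d_k-2)$, $C(y_1,\dots,y_k)$ is the caterpillar obtained from a path $v_0v_1\cdots v_kv_{k+1}$ by attaching $y_j$ new pendant vertices to $v_j$ for $j=1,\dots,k$ (so $v_j$ has degree $y_j+2$); it has degree sequence $\pi$. *)

theory Defs
  imports Main "HOL-Library.Multiset"
begin

(* Finite simple undirected graphs (V, E), with edges as two-element sets of vertices.
   The predicate tree of Graph_Theory is about directed cycles, and a symmetric digraph
   with an edge is never a tree there, so it is not the undirected notion needed here. *)

type_synonym 'a ugraph = "'a set \<times> 'a set set"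

definition verts :: "'a ugraph \<Rightarrow> 'a set" where
  "verts G = fst G"

definition edges :: "'a ugraph \<Rightarrow> 'a set set" where
  "edges G = snd G"

definition simple_graph :: "'a ugraph \<Rightarrow> bool" where
  "simple_graph G \<longleftrightarrow>
     finite (verts G) \<and> (\<forall>e \<in> edges G. e \<subseteq> verts G \<and> card e = 2)"

definition degree :: "'a ugraph \<Rightarrow> 'a \<Rightarrow> nat" where
  "degree G v = card {e \<in> edges G. v \<in> e}"

definition walk :: "'a ugraph \<Rightarrow> 'a list \<Rightarrow> bool" where
  "walk G p \<longleftrightarrow>
     p \<noteq> [] \<and> set p \<subseteq> verts G \<and> successively (\<lambda>u v. {u, v} \<in> edges G) p"

definition connected_graph :: "'a ugraph \<Rightarrow> bool" where
  "connected_graph G \<longleftrightarrow>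
     (\<forall>u \<in> verts G. \<forall>v \<in> verts G. \<exists>p. walk G p \<and> hd p = u \<and> last p = v)"

definition graph_cycle :: "'a ugraph \<Rightarrow> 'a list \<Rightarrow> bool" where
  "graph_cycle G p \<longleftrightarrow>
     walk G p \<and> distinct p \<and> length p \<ge> 3 \<and> {last p, hd p} \<in> edges G"

definition tree :: "'a ugraph \<Rightarrow> bool" where
  "tree G \<longleftrightarrow>
     simple_graph G \<and> verts G \<noteq> {} \<and> connected_graph G \<and> (\<nexists>p. graph_cycle G p)"

definition subgraph :: "'a ugraph \<Rightarrow> 'a ugraph \<Rightarrow> bool" where
  "subgraph H G \<longleftrightarrow>
     simple_graph H \<and> verts H \<subseteq> verts G \<and> edges H \<subseteq> edges G"

definition subtrees :: "'a ugraph \<Rightarrow> 'a ugraph set" where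
  "subtrees T = {S. subgraph S T \<and> verts S \<noteq> {} \<and> connected_graph S}"

definition num_subtrees :: "'a ugraph \<Rightarrow> nat" where
  "num_subtrees T = card (subtrees T)"

(* The sequence is d 1, ..., d n; values of d outside {1..n} are irrelevant. *)
definition has_degree_sequence :: "'a ugraph \<Rightarrow> nat \<Rightarrow> (nat \<Rightarrow> nat) \<Rightarrow> bool" where
  "has_degree_sequence G n d \<longleftrightarrow>
     image_mset (degree G) (mset_set (verts G)) = image_mset d (mset_set {1..n})"

definition trees_with_degrees :: "nat \<Rightarrow> (nat \<Rightarrow> nat) \<Rightarrow> 'a ugraph set" where
  "trees_with_degrees n d = {T. tree T \<and> has_degree_sequence T n d}"

definition isomorphic :: "'a ugraph \<Rightarrow> 'b ugraph \<Rightarrow> bool" where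
  "isomorphic G H \<longleftrightarrow>
     (\<exists>f. bij_betw f (verts G) (verts H) \<and>
          (\<forall>u \<in> verts G. \<forall>v \<in> verts G. {u, v} \<in> edges G \<longleftrightarrow> {f u, f v} \<in> edges H))"

(* Spine j is v_j; Pendant j i is the i-th new vertex attached to v_j. *)
datatype cat_vertex = Spine nat | Pendant nat nat

(* For ys = [y_1, ..., y_k], the number y_j is ys ! (j - 1). *)
definition caterpillar :: "nat list \<Rightarrow> cat_vertex ugraph" where
  "caterpillar ys = (let k = length ys in
     (Spine ` {0..k + 1} \<union>
        {Pendant j i | j i. j \<in> {1..k} \<and> i \<in> {1..ys ! (j - 1)}},
      {{Spine j, Spine (j + 1)} | j. j \<in> {0..k}} \<union>
        {{Spine j, Pendant j i} | j i. j \<in> {1..k} \<and> i \<in> {1..ys ! (j - 1)}}))"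

end

theory Submission
  imports Defs
begin

text \<open>
  Since a subtree of a tree is the induced subgraph on its vertex set, subtrees are counted by
  vertex sets. Such a set is a single leaf, or a connected part \<open>J\<close> of the core (the internal
  vertices) together with any set of leaves attached to \<open>J\<close>, so that
  \<open>\<phi>(T) = (n - k) + (\<Sum>J. 2^l(J))\<close>, where \<open>J\<close> ranges over the nonempty connected parts of the core
  and \<open>l(J)\<close> is the number of leaves at \<open>J\<close>. For \<open>k \<le> 4\<close> the
  core is a path or, when \<open>k = 4\<close>, possibly a star. A star is beaten by some path with the same
  degrees. On a path, exchanging an end vertex with an inner vertex of larger degree strictly lowers
  the count, so a minimizer has the two largest degrees at its ends, and the two remaining
  arrangements for \<open>k = 4\<close> differ by \<open>2 (A - B) (C - D)\<close> in terms of the powers of two.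
\<close>

section \<open>Subtrees as connected vertex sets\<close>

text \<open>With cuts, removing leaves, adding leaves and transporting along a bijection are plain
  set manipulations, with no walks to reroute. The core together with the number of leaves at each
  of its vertices fixes both the count and the isomorphism type, so an arbitrary tree and the
  caterpillar are instances of one structure. The two ends of the caterpillar's path count as
  leaves: a vertex of degree \<open>y + 2\<close> carries \<open>y + 1\<close> leaves at an end of
  the core and \<open>y\<close> leaves inside it. The number of leaves is the same for all trees in
  question, and with \<open>p = 2 ^ y\<close> the rest of the count becomes a polynomial whose
  change under an exchange factors into terms of known sign. The equality case comes out of the same
  argument: each exchange and the passage from a star to a path are strict, so equality forces the
  sorted path, which is unique up to reversal even when degrees coincide. Powers of two are
  injective, so the leaf numbers along the two paths agree, and this yields the isomorphism.\<close>

text \<open>Connectedness expressed by cuts instead of walks.\<close>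

definition linked :: "'a set set \<Rightarrow> 'a set \<Rightarrow> bool" where
  "linked E W \<longleftrightarrow> (\<forall>X. X \<noteq> {} \<longrightarrow> X \<subset> W \<longrightarrow> (\<exists>x\<in>X. \<exists>y\<in>W - X. {x, y} \<in> E))"

lemma linkedD:
  assumes "linked E W" "X \<subseteq> W" "X \<noteq> {}" "X \<noteq> W"
  obtains x y where "x \<in> X" "y \<in> W" "y \<notin> X" "{x, y} \<in> E"
proof -
  have "X \<subset> W" using assms by auto
  then have "\<exists>x\<in>X. \<exists>y\<in>W - X. {x, y} \<in> E" using assms(1,3) unfolding linked_def by auto
  then show thesis using that by auto
qed

lemma linked_singleton: "linked E {v}"
  by (auto simp: linked_def)

lemma linked_isolatedD:
  assumes "linked E J" "v \<in> J" "\<And>u. u \<in> J \<Longrightarrow> u \<noteq> v \<Longrightarrow> {v, u} \<notin> E"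
  shows "J = {v}"
proof (rule ccontr)
  assume "J \<noteq> {v}"
  then obtain x y where "x \<in> {v}" "y \<in> J" "y \<notin> {v}" "{x, y} \<in> E"
    using linkedD[of E J "{v}"] assms by auto
  with assms(3)[of y] show False by auto
qed

lemma linked_insert:
  assumes "linked E J" "u \<in> J" "{v, u} \<in> E"
  shows "linked E (insert v J)"
  unfolding linked_def
proof (intro allI impI)
  fix X assume X: "X \<noteq> {}" "X \<subset> insert v J"
  show "\<exists>x\<in>X. \<exists>y\<in>insert v J - X. {x, y} \<in> E"
  proof (cases "X \<inter> J = {} \<or> J \<subseteq> X")
    case True
    then show ?thesis
    proof
      assume "X \<inter> J = {}"
      with X assms show ?thesis by blast
    next
      assume "J \<subseteq> X"
      with X assms show ?thesis by (metis Diff_iff insertCI insert_commute insert_subset psubsetE subsetD subset_antisym)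
    qed
  next
    case False
    then obtain x y where "x \<in> X \<inter> J" "y \<in> J" "y \<notin> X \<inter> J" "{x, y} \<in> E"
      using linkedD[OF assms(1), of "X \<inter> J"] by (metis inf.cobounded2 inf.absorb_iff2 inf_commute)
    then show ?thesis by blast
  qed
qed

lemma walk_crossing:
  assumes "successively (\<lambda>u v. {u, v} \<in> E) p" "p \<noteq> []" "hd p \<in> X" "last p \<notin> X"
  shows "\<exists>x\<in>set p \<inter> X. \<exists>y\<in>set p - X. {x, y} \<in> E"
  using assms
proof (induction p rule: induct_list012)
  case (3 a b p)
  then show ?case
    by (cases "b \<in> X") auto
qed auto

lemma connected_imp_linked:
  assumes "connected_graph G"
  shows "linked (edges G) (verts G)"
  unfolding linked_def
proof (intro allI impI)
  fix X assume X: "X \<noteq> {}" "X \<subset> verts G"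
  then obtain u v where "u \<in> X" "v \<in> verts G" "v \<notin> X" by blast
  then obtain p where "walk G p" "hd p = u" "last p = v"
    using assms X unfolding connected_graph_def by blast
  then show "\<exists>x\<in>X. \<exists>y\<in>verts G - X. {x, y} \<in> edges G"
    using walk_crossing[of "edges G" p X] \<open>u \<in> X\<close> \<open>v \<notin> X\<close> unfolding walk_def by blast
qed

text \<open>Let \<open>X\<close> collect the endpoints of the duplicate-free walks from
  \<open>u\<close>. Prefixes of such walks put all their vertices into \<open>X\<close>, so an
  endpoint of a cut edge outside \<open>X\<close> is not on the walk to the other endpoint and can
  be appended to it. Hence no edge leaves \<open>X\<close>. Distinctness is what later lets such a
  walk serve as a cycle.\<close>

lemma linked_imp_path:
  assumes linked: "linked (edges G) (verts G)" and u: "u \<in> verts G" and v: "v \<in> verts G"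
  shows "\<exists>p. walk G p \<and> distinct p \<and> hd p = u \<and> last p = v"
proof -
  define X where "X = {w \<in> verts G. \<exists>p. walk G p \<and> distinct p \<and> hd p = u \<and> last p = w}"
  have "walk G [u] \<and> distinct [u] \<and> hd [u] = u \<and> last [u] = u"
    using u by (simp add: walk_def)
  then have "u \<in> X" unfolding X_def using u by blast
  have prefix: "w \<in> X" if p: "walk G p" "distinct p" "hd p = u" and w: "w \<in> set p" for p w
  proof -
    obtain q r where qr: "p = q @ w # r" using w by (meson split_list)
    then have "p = (q @ [w]) @ r" by simp
    then have "walk G (q @ [w])" "distinct (q @ [w])" "hd (q @ [w]) = u"
      using p unfolding walk_def by (auto simp: successively_append_iff hd_append)
    moreover have "last (q @ [w]) = w" "w \<in> verts G" using p w by (auto simp: walk_def)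
    ultimately show ?thesis unfolding X_def by blast
  qed
  have "X = verts G"
  proof (rule ccontr)
    assume "X \<noteq> verts G"
    moreover have "X \<subseteq> verts G" "X \<noteq> {}" using \<open>u \<in> X\<close> by (auto simp: X_def)
    ultimately obtain x y where xy: "x \<in> X" "y \<in> verts G" "y \<notin> X" "{x, y} \<in> edges G"
      using linkedD[OF linked] by blast
    then obtain p where p: "walk G p" "distinct p" "hd p = u" "last p = x" by (auto simp: X_def)
    have "y \<notin> set p" using prefix p xy by blast
    then have "walk G (p @ [y])" "distinct (p @ [y])" "hd (p @ [y]) = u" "last (p @ [y]) = y"
      using p xy by (auto simp: walk_def successively_append_iff)
    then show False using xy by (auto simp: X_def)
  qed
  then show ?thesis using v by (auto simp: X_def)
qed

lemma connected_graph_iff_linked: "connected_graph G \<longleftrightarrow> linked (edges G) (verts G)"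
proof
  assume "linked (edges G) (verts G)"
  then show "connected_graph G"
    unfolding connected_graph_def using linked_imp_path[of G] by blast
qed (rule connected_imp_linked)

lemma linked_cong:
  assumes "\<And>x y. x \<in> W \<Longrightarrow> y \<in> W \<Longrightarrow> {x, y} \<in> E \<longleftrightarrow> {x, y} \<in> F"
  shows "linked E W = linked F W"
proof -
  have "(\<exists>x\<in>X. \<exists>y\<in>W - X. {x, y} \<in> E) \<longleftrightarrow> (\<exists>x\<in>X. \<exists>y\<in>W - X. {x, y} \<in> F)" if "X \<subset> W" for X
    using assms that by (intro bex_cong refl) auto
  then show ?thesis unfolding linked_def by auto
qed

lemma simple_graph_verts: "simple_graph G \<Longrightarrow> {u, v} \<in> edges G \<Longrightarrow> u \<in> verts G \<and> v \<in> verts G"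
  unfolding simple_graph_def by (metis insert_subset)

text \<open>For an edge \<open>e\<close> of \<open>G\<close> inside \<open>verts S\<close>, a
  distinct walk in \<open>S\<close> between its ends would close up with \<open>e\<close> to a cycle
  if it had three or more vertices. So it has exactly two, and its single edge is
  \<open>e\<close>.\<close>

lemma connected_subgraph_induced:
  assumes acyclic: "\<nexists>p. graph_cycle G p" and G: "simple_graph G"
    and S: "subgraph S G" "connected_graph S"
  shows "edges S = {e \<in> edges G. e \<subseteq> verts S}"
proof
  show "edges S \<subseteq> {e \<in> edges G. e \<subseteq> verts S}"
    using S by (auto simp: subgraph_def simple_graph_def)
  show "{e \<in> edges G. e \<subseteq> verts S} \<subseteq> edges S"
  proof safe
    fix e assume e: "e \<in> edges G" "e \<subseteq> verts S"
    then have "card e = 2" using G by (auto simp: simple_graph_def)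
    then obtain u v where uv: "e = {u, v}" "u \<noteq> v" by (auto simp: card_2_iff)
    then obtain p where p: "walk S p" "distinct p" "hd p = u" "last p = v"
      using linked_imp_path[of S u v] S e by (auto simp: connected_graph_iff_linked)
    have "walk G p"
    proof -
      have "successively (\<lambda>u v. {u, v} \<in> edges G) p"
        by (rule successively_mono[of "\<lambda>u v. {u, v} \<in> edges S"])
           (use p S in \<open>auto simp: walk_def subgraph_def\<close>)
      then show ?thesis using p S by (auto simp: walk_def subgraph_def)
    qed
    show "e \<in> edges S"
    proof (cases "length p \<ge> 3")
      case True
      then have "graph_cycle G p"
        using \<open>walk G p\<close> p uv e by (auto simp: graph_cycle_def insert_commute)
      with acyclic show ?thesis by blast
    next
      case False
      then consider "p = []" | a where "p = [a]" | a b where "p = [a, b]"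
        by (cases p; cases "tl p"; cases "tl (tl p)") auto
      then show ?thesis
        by cases (use p uv in \<open>auto simp: walk_def\<close>)
    qed
  qed
qed

lemma num_subtrees_eq_card_linked:
  assumes acyclic: "\<nexists>p. graph_cycle G p" and G: "simple_graph G"
  shows "num_subtrees G = card {W. W \<subseteq> verts G \<and> W \<noteq> {} \<and> linked (edges G) W}"
proof -
  define ind where "ind W = (W, {e \<in> edges G. e \<subseteq> W})" for W
  have linked_ind: "connected_graph (ind W) \<longleftrightarrow> linked (edges G) W" for W
    unfolding connected_graph_iff_linked ind_def
    by (simp add: verts_def edges_def) (rule linked_cong, auto)
  have "subtrees G = ind ` {W. W \<subseteq> verts G \<and> W \<noteq> {} \<and> linked (edges G) W}"
  proof (intro equalityI subsetI)
    fix S assume "S \<in> subtrees G"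
    then have S: "subgraph S G" "connected_graph S" "verts S \<noteq> {}" by (auto simp: subtrees_def)
    then have "S = ind (verts S)"
      using connected_subgraph_induced[OF acyclic G]
      by (metis edges_def ind_def prod.collapse verts_def)
    then show "S \<in> ind ` {W. W \<subseteq> verts G \<and> W \<noteq> {} \<and> linked (edges G) W}"
      using S linked_ind by (metis (mono_tags, lifting) image_eqI mem_Collect_eq subgraph_def)
  next
    fix S assume "S \<in> ind ` {W. W \<subseteq> verts G \<and> W \<noteq> {} \<and> linked (edges G) W}"
    then obtain W where W: "S = ind W" "W \<subseteq> verts G" "W \<noteq> {}" "linked (edges G) W" by blast
    moreover have "subgraph (ind W) G"
      using W G finite_subset[of W "verts G"] by (auto simp: subgraph_def simple_graph_def ind_def verts_def edges_def)
    ultimately show "S \<in> subtrees G"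
      using linked_ind by (auto simp: subtrees_def ind_def verts_def)
  qed
  moreover have "inj_on ind A" for A by (auto simp: inj_on_def ind_def)
  ultimately show ?thesis by (simp add: num_subtrees_def card_image)
qed

section \<open>Invariance of the subtree count under isomorphism\<close>

lemma linked_image:
  assumes "inj_on f V" "W \<subseteq> V"
    and "\<And>u v. u \<in> V \<Longrightarrow> v \<in> V \<Longrightarrow> {u, v} \<in> E \<longleftrightarrow> {f u, f v} \<in> F"
  shows "linked F (f ` W) = linked E W"
proof -
  have "linked E W" if l: "linked F (f ` W)"
    unfolding linked_def
  proof (intro allI impI)
    fix X assume X: "X \<noteq> {}" "X \<subset> W"
    then have "f ` X \<noteq> f ` W" "f ` X \<subseteq> f ` W" "f ` X \<noteq> {}"
      using assms by (auto simp: inj_on_image_eq_iff dest: psubset_imp_subset)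
    then obtain x y where "x \<in> f ` X" "y \<in> f ` W" "y \<notin> f ` X" "{x, y} \<in> F"
      using linkedD[OF l] by metis
    then obtain a b where "a \<in> X" "x = f a" "b \<in> W" "y = f b" "b \<notin> X" by blast
    moreover have "a \<in> V" "b \<in> V" using \<open>a \<in> X\<close> \<open>b \<in> W\<close> X assms(2) by auto
    ultimately show "\<exists>x\<in>X. \<exists>y\<in>W - X. {x, y} \<in> E"
      using \<open>{x, y} \<in> F\<close> assms(3) by blast
  qed
  moreover have "linked F (f ` W)" if l: "linked E W"
    unfolding linked_def
  proof (intro allI impI)
    fix X assume X: "X \<noteq> {}" "X \<subset> f ` W"
    define Y where "Y = {w \<in> W. f w \<in> X}"
    have "f ` Y = X" using X by (auto simp: Y_def)
    then have "Y \<noteq> {}" "Y \<noteq> W" "Y \<subseteq> W" using X by (auto simp: Y_def)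
    then obtain x y where "x \<in> Y" "y \<in> W" "y \<notin> Y" "{x, y} \<in> E"
      using linkedD[OF l] by metis
    moreover have "{f x, f y} \<in> F" using assms(2,3) calculation by (metis subsetD Y_def mem_Collect_eq)
    ultimately show "\<exists>x\<in>X. \<exists>y\<in>f ` W - X. {x, y} \<in> F"
      unfolding Y_def by blast
  qed
  ultimately show ?thesis by blast
qed

lemma isomorphic_num_subtrees:
  assumes "\<nexists>p. graph_cycle G p" "simple_graph G" "\<nexists>p. graph_cycle H p" "simple_graph H"
    and "isomorphic G H"
  shows "num_subtrees G = num_subtrees H"
proof -
  obtain f where f: "bij_betw f (verts G) (verts H)"
      "\<And>u v. u \<in> verts G \<Longrightarrow> v \<in> verts G \<Longrightarrow> {u, v} \<in> edges G \<longleftrightarrow> {f u, f v} \<in> edges H"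
    using assms(5) unfolding isomorphic_def by blast
  have "inj_on f (verts G)" "f ` verts G = verts H" using f by (auto simp: bij_betw_def)
  have lf: "linked (edges H) (f ` W) = linked (edges G) W" if "W \<subseteq> verts G" for W
    using linked_image[OF \<open>inj_on f _\<close> that f(2)] .
  have "bij_betw (image f) {W. W \<subseteq> verts G \<and> W \<noteq> {} \<and> linked (edges G) W}
      {W. W \<subseteq> verts H \<and> W \<noteq> {} \<and> linked (edges H) W}"
  proof (rule bij_betw_imageI)
    show "inj_on (image f) {W. W \<subseteq> verts G \<and> W \<noteq> {} \<and> linked (edges G) W}"
      using \<open>inj_on f _\<close> by (auto simp: inj_on_def inj_on_image_eq_iff[OF \<open>inj_on f _\<close>])
    show "image f ` {W. W \<subseteq> verts G \<and> W \<noteq> {} \<and> linked (edges G) W} =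
        {W. W \<subseteq> verts H \<and> W \<noteq> {} \<and> linked (edges H) W}"
    proof (intro equalityI subsetI)
      fix W assume "W \<in> image f ` {W. W \<subseteq> verts G \<and> W \<noteq> {} \<and> linked (edges G) W}"
      then show "W \<in> {W. W \<subseteq> verts H \<and> W \<noteq> {} \<and> linked (edges H) W}"
        using lf \<open>f ` verts G = verts H\<close> by auto
    next
      fix W assume W: "W \<in> {W. W \<subseteq> verts H \<and> W \<noteq> {} \<and> linked (edges H) W}"
      then obtain U where "U \<subseteq> verts G" "W = f ` U"
        using \<open>f ` verts G = verts H\<close> by (metis (mono_tags, lifting) mem_Collect_eq subset_imageE)
      then show "W \<in> image f ` {W. W \<subseteq> verts G \<and> W \<noteq> {} \<and> linked (edges G) W}"
        using W lf by auto
    qed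
  qed
  then show ?thesis
    using assms by (simp add: num_subtrees_eq_card_linked bij_betw_same_card)
qed

text \<open>A vertex of maximal rank on a cycle has both of its cycle neighbours below it.\<close>

lemma acyclicI_rank:
  fixes r :: "'a \<Rightarrow> nat"
  assumes "\<And>v u w. \<lbrakk>{v, u} \<in> edges G; {v, w} \<in> edges G; r u \<le> r v; r w \<le> r v\<rbrakk> \<Longrightarrow> u = w"
  shows "\<nexists>p. graph_cycle G p"
proof
  assume "\<exists>p. graph_cycle G p"
  then obtain p where p: "walk G p" "distinct p" "length p \<ge> 3" "{last p, hd p} \<in> edges G"
    by (auto simp: graph_cycle_def)
  let ?m = "length p"
  have "finite ((\<lambda>i. r (p ! i)) ` {..<?m})" "(\<lambda>i. r (p ! i)) ` {..<?m} \<noteq> {}"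
    using p by (auto simp: lessThan_empty_iff bot_nat_def)
  note Max = Max_in[OF this] Max_ge[OF this(1)]
  then obtain i where i0: "i < ?m" "Max ((\<lambda>i. r (p ! i)) ` {..<?m}) = r (p ! i)"
    by auto
  then have i: "i < ?m" "\<And>j. j < ?m \<Longrightarrow> r (p ! j) \<le> r (p ! i)"
    using Max(2) by auto
  have step: "{p ! j, p ! (Suc j mod ?m)} \<in> edges G" if "j < ?m" for j
  proof (cases "Suc j < ?m")
    case True
    then show ?thesis using p(1) by (auto simp: walk_def successively_conv_nth)
  next
    case False
    then have "j = ?m - 1" "Suc j = ?m" using that by auto
    then show ?thesis using p by (auto simp: last_conv_nth hd_conv_nth walk_def)
  qed
  \<comment> \<open>\<open>a\<close> and \<open>b\<close> are the cyclic predecessor and successor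
    of the position \<open>i\<close> of maximal rank. They differ because the cycle has length at
    least three, whereas the rank hypothesis identifies the two vertices.\<close>
  define a where "a = (if i = 0 then ?m - 1 else i - 1)"
  define b where "b = Suc i mod ?m"
  have a: "a < ?m" "Suc a mod ?m = i" using i p by (auto simp: a_def)
  have b: "b < ?m" unfolding b_def by (rule mod_less_divisor) (use p in linarith)
  have "a \<noteq> b" using i p by (auto simp: a_def b_def mod_Suc split: if_splits)
  have "p ! a = p ! b"
    using step[OF a(1)] step[OF i(1)] i(2)[OF a(1)] i(2)[OF b] a(2)
    by (intro assms[of "p ! i"]) (auto simp: insert_commute b_def)
  with \<open>a \<noteq> b\<close> p a b show False by (simp add: nth_eq_iff_index_eq)
qed

section \<open>Graphs with a core and pendant leaves\<close>

text \<open>In \<open>leaf_edge\<close> the vertex \<open>u\<close> is arbitrary, so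
  \<open>par l\<close> is the only neighbour of \<open>l\<close>; with \<open>par_core\<close> this
  also excludes edges between two leaves.\<close>

locale cored_graph =
  fixes G :: "'a ugraph" and I :: "'a set" and par :: "'a \<Rightarrow> 'a"
  assumes simple: "simple_graph G"
    and acyclic: "\<nexists>p. graph_cycle G p"
    and core_subset: "I \<subseteq> verts G"
    and par_core: "l \<in> verts G \<Longrightarrow> l \<notin> I \<Longrightarrow> par l \<in> I"
    and leaf_edge: "l \<in> verts G \<Longrightarrow> l \<notin> I \<Longrightarrow> {l, u} \<in> edges G \<longleftrightarrow> u = par l"
begin

definition leaves_at :: "'a \<Rightarrow> 'a set" where
  "leaves_at v = {l \<in> verts G - I. par l = v}"

definition load :: "'a \<Rightarrow> nat" where
  "load v = card (leaves_at v)"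

lemma finite_verts: "finite (verts G)"
  using simple by (simp add: simple_graph_def)

lemma finite_core: "finite I"
  by (rule finite_subset[OF core_subset finite_verts])

lemma finite_leaves_at: "finite (leaves_at v)"
  using finite_verts by (simp add: leaves_at_def)

lemma card_leaves_below:
  assumes "J \<subseteq> I"
  shows "card {l \<in> verts G - I. par l \<in> J} = sum load J"
proof -
  have "{l \<in> verts G - I. par l \<in> J} = (\<Union>v\<in>J. leaves_at v)" by (auto simp: leaves_at_def)
  moreover have "card (\<Union>v\<in>J. leaves_at v) = (\<Sum>v\<in>J. card (leaves_at v))"
    using assms finite_core finite_leaves_at
    by (intro card_UN_disjoint) (auto simp: leaves_at_def intro: finite_subset)
  ultimately show ?thesis by (simp add: load_def)
qed

lemma card_leaves: "card (verts G - I) = sum load I"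
proof -
  have "{l \<in> verts G - I. par l \<in> I} = verts G - I" using par_core by blast
  then show ?thesis using card_leaves_below[of I] by simp
qed

text \<open>A cut \<open>X\<close> of the core part extends to the cut \<open>Y\<close> of
  \<open>W\<close> by adding the leaves that hang on \<open>X\<close>. An edge crossing
  \<open>Y\<close> cannot end in a leaf, since a leaf always lies on the same side as its parent; so
  it already crosses \<open>X\<close>.\<close>

lemma linked_core_part:
  assumes W: "W \<subseteq> verts G" and linked: "linked (edges G) W"
  shows "linked (edges G) (W \<inter> I)"
  unfolding linked_def
proof (intro allI impI)
  fix X assume X: "X \<noteq> {}" "X \<subset> W \<inter> I"
  define Y where "Y = X \<union> {l \<in> W - I. par l \<in> X}"
  have "Y \<subseteq> W" "Y \<noteq> {}" "Y \<noteq> W" using X by (auto simp: Y_def)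
  then obtain x y where xy: "x \<in> Y" "y \<in> W" "y \<notin> Y" "{x, y} \<in> edges G"
    using linkedD[OF linked] by metis
  have x: "x \<in> I"
  proof (rule ccontr)
    assume "x \<notin> I"
    moreover have "x \<in> verts G" using \<open>x \<in> Y\<close> \<open>Y \<subseteq> W\<close> W by auto
    ultimately have "y = par x" using leaf_edge xy by blast
    then show False using xy \<open>x \<notin> I\<close> X by (auto simp: Y_def)
  qed
  then have "x \<in> X" using xy by (auto simp: Y_def)
  moreover have "y \<in> I"
  proof (rule ccontr)
    assume "y \<notin> I"
    moreover have "y \<in> verts G" using xy W by auto
    moreover have "{y, x} \<in> edges G" using xy by (simp add: insert_commute)
    ultimately have "x = par y" using leaf_edge by blast
    then show False using xy \<open>y \<notin> I\<close> \<open>x \<in> X\<close> by (auto simp: Y_def)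
  qed
  ultimately show "\<exists>x\<in>X. \<exists>y\<in>W \<inter> I - X. {x, y} \<in> edges G" using xy by (auto simp: Y_def)
qed

lemma linked_leaf_par:
  assumes W: "W \<subseteq> verts G" and linked: "linked (edges G) W"
    and l: "l \<in> W" "l \<notin> I" "W \<noteq> {l}"
  shows "par l \<in> W"
proof -
  obtain x y where "x \<in> {l}" "y \<in> W" "y \<notin> {l}" "{x, y} \<in> edges G"
    using linkedD[OF linked, of "{l}"] l by auto
  then show ?thesis using leaf_edge l W by auto
qed

lemma linked_add_leaves:
  assumes J: "J \<subseteq> I" "J \<noteq> {}" "linked (edges G) J" and L: "L \<subseteq> {l \<in> verts G - I. par l \<in> J}"
  shows "linked (edges G) (J \<union> L)"
proof -
  have "finite L" using L finite_verts by (auto intro: finite_subset)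
  then show ?thesis using L
  proof (induction L)
    case (insert l L)
    then have "linked (edges G) (insert l (J \<union> L))"
      using leaf_edge by (intro linked_insert[of _ _ "par l"]) auto
    then show ?case by simp
  qed (use J in simp)
qed

text \<open>A linked set other than a single leaf splits uniquely into its core part
  \<open>J\<close> and a subset of the leaves at \<open>J\<close>, which gives
  \<open>2 ^ sum load J\<close> choices. The sum runs over all of \<open>Pow I\<close>, with zero
  for the excluded sets, so that for an explicitly listed core it can be expanded one vertex at a
  time.\<close>

lemma num_subtrees_cored:
  "num_subtrees G =
     sum load I + (\<Sum>J\<in>Pow I. if J \<noteq> {} \<and> linked (edges G) J then 2 ^ sum load J else 0)"
proof -
  define \<J> where "\<J> = {J \<in> Pow I. J \<noteq> {} \<and> linked (edges G) J}"
  define B where "B J = {l \<in> verts G - I. par l \<in> J}" for J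
  have "finite \<J>" using finite_core by (simp add: \<J>_def)
  have finB: "finite (B J)" for J using finite_verts by (simp add: B_def)
  have disj: "B J \<inter> I = {}" for J by (auto simp: B_def)
  have "{W. W \<subseteq> verts G \<and> W \<noteq> {} \<and> linked (edges G) W} =
      (\<lambda>l. {l}) ` (verts G - I) \<union> (\<Union>J\<in>\<J>. (\<lambda>L. J \<union> L) ` Pow (B J))" (is "?A = ?S \<union> ?U")
  proof (intro equalityI subsetI)
    fix W assume "W \<in> ?A"
    then have W: "W \<subseteq> verts G" "W \<noteq> {}" "linked (edges G) W" by auto
    show "W \<in> ?S \<union> ?U"
    proof (cases "\<exists>l. W = {l} \<and> l \<notin> I")
      case True
      then show ?thesis using W by auto
    next
      case False
      then have par: "par l \<in> W \<inter> I" if "l \<in> W" "l \<notin> I" for l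
        using linked_leaf_par[of W l] W par_core that by blast
      then have "W \<inter> I \<in> \<J>" using W linked_core_part by (auto simp: \<J>_def)
      moreover have "W = W \<inter> I \<union> (W - I)" "W - I \<in> Pow (B (W \<inter> I))"
        using par W by (auto simp: B_def)
      ultimately show ?thesis by blast
    qed
  next
    fix W assume "W \<in> ?S \<union> ?U"
    then show "W \<in> ?A"
    proof
      assume "W \<in> ?S"
      then show ?thesis by (auto intro: linked_singleton)
    next
      assume "W \<in> ?U"
      then obtain J L where "J \<in> \<J>" "L \<subseteq> B J" "W = J \<union> L" by blast
      then show ?thesis using linked_add_leaves[of J L] core_subset by (auto simp: \<J>_def B_def)
    qed
  qed
  moreover have "?S \<inter> ?U = {}"
  proof -
    have "l \<in> I" if "J \<in> \<J>" "{l} = J \<union> L" for l J L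
      using that by (auto simp: \<J>_def)
    then show ?thesis by auto
  qed
  moreover have "finite ?S" "finite ?U" using finite_verts \<open>finite \<J>\<close> finB by auto
  moreover have "card ?S = sum load I" by (simp add: card_image card_leaves)
  moreover have "card ?U = (\<Sum>J\<in>\<J>. 2 ^ sum load J)"
  proof -
    have "card ?U = (\<Sum>J\<in>\<J>. card ((\<lambda>L. J \<union> L) ` Pow (B J)))"
    proof (rule card_UN_disjoint)
      show "\<forall>J\<in>\<J>. \<forall>K\<in>\<J>. J \<noteq> K \<longrightarrow> (\<union>) J ` Pow (B J) \<inter> (\<union>) K ` Pow (B K) = {}"
      proof (intro ballI impI)
        fix J K assume JK: "J \<in> \<J>" "K \<in> \<J>" "J \<noteq> K"
        \<comment> \<open>The core part is recovered by intersecting with \<open>I\<close>, hence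
          the families for different \<open>J\<close> are disjoint.\<close>
        have "(J \<union> L) \<inter> I = J" if "J \<in> \<J>" "L \<subseteq> B J" for J L
          using that disj[of J] by (auto simp: \<J>_def)
        then have "J \<union> L \<noteq> K \<union> M" if "L \<subseteq> B J" "M \<subseteq> B K" for L M
          using JK that by metis
        then show "(\<union>) J ` Pow (B J) \<inter> (\<union>) K ` Pow (B K) = {}" by blast
      qed
    qed (use \<open>finite \<J>\<close> finB in auto)
    also have "\<dots> = (\<Sum>J\<in>\<J>. 2 ^ sum load J)"
    proof (rule sum.cong[OF refl])
      fix J assume J: "J \<in> \<J>"
      then have "inj_on (\<lambda>L. J \<union> L) (Pow (B J))"
        using disj[of J] by (intro inj_on_inverseI[of _ "\<lambda>W. W - J"]) (auto simp: \<J>_def)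
      then have "card ((\<lambda>L. J \<union> L) ` Pow (B J)) = 2 ^ card (B J)"
        using finB by (simp add: card_image card_Pow)
      moreover have "card (B J) = sum load J"
        using J card_leaves_below[of J] by (simp add: B_def \<J>_def)
      ultimately show "card ((\<lambda>L. J \<union> L) ` Pow (B J)) = 2 ^ sum load J" by simp
    qed
    finally show ?thesis .
  qed
  moreover have "(\<Sum>J\<in>\<J>. 2 ^ sum load J) =
      (\<Sum>J\<in>Pow I. if J \<noteq> {} \<and> linked (edges G) J then 2 ^ sum load J else (0::nat))"
    unfolding \<J>_def using finite_core by (intro sum.inter_filter) auto
  ultimately show ?thesis
    using num_subtrees_eq_card_linked[OF acyclic simple] by (simp add: card_Un_disjoint)
qed

lemma degree_core:
  assumes v: "v \<in> I"
  shows "degree G v = load v + card {u \<in> I. {u, v} \<in> edges G}"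
proof -
  have v': "v \<in> verts G" using v core_subset by auto
  have "{e \<in> edges G. v \<in> e} = (\<lambda>u. {u, v}) ` {u \<in> verts G. {u, v} \<in> edges G}" (is "?L = ?R")
  proof (intro equalityI subsetI)
    fix e assume e: "e \<in> ?L"
    then have "card e = 2" "e \<subseteq> verts G" using simple by (auto simp: simple_graph_def)
    then obtain x y where "e = {x, y}" unfolding card_2_iff by blast
    with e obtain u where "e = {u, v}" by (auto simp: insert_commute)
    then show "e \<in> ?R" using e \<open>e \<subseteq> verts G\<close> by auto
  next
    fix e assume "e \<in> ?R"
    then show "e \<in> ?L" by blast
  qed
  moreover have "inj_on (\<lambda>u. {u, v}) {u \<in> verts G. {u, v} \<in> edges G}"
    by (auto simp: inj_on_def doubleton_eq_iff)
  moreover have "{u \<in> verts G. {u, v} \<in> edges G} = leaves_at v \<union> {u \<in> I. {u, v} \<in> edges G}"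
    using leaf_edge core_subset by (auto simp: leaves_at_def)
  moreover have "leaves_at v \<inter> {u \<in> I. {u, v} \<in> edges G} = {}" by (auto simp: leaves_at_def)
  ultimately show ?thesis
    using finite_leaves_at finite_core by (simp add: degree_def load_def card_image card_Un_disjoint)
qed

end

text \<open>Equal loads provide a bijection \<open>h v\<close> between the leaves at
  \<open>v\<close> and those at \<open>g v\<close>. Glued together and combined with
  \<open>g\<close>, these bijections respect leaf edges, because a leaf is adjacent to its parent
  alone.\<close>

lemma cored_graph_isomorphic:
  assumes G: "cored_graph G I par" and H: "cored_graph H J par'"
    and g: "bij_betw g I J"
    and adj: "\<And>u v. u \<in> I \<Longrightarrow> v \<in> I \<Longrightarrow> {u, v} \<in> edges G \<longleftrightarrow> {g u, g v} \<in> edges H"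
    and load: "\<And>v. v \<in> I \<Longrightarrow> cored_graph.load G I par v = cored_graph.load H J par' (g v)"
  shows "isomorphic G H"
proof -
  interpret G: cored_graph G I par by fact
  interpret H: cored_graph H J par' by fact
  have "\<forall>v\<in>I. \<exists>h. bij_betw h (G.leaves_at v) (H.leaves_at (g v))"
    using load G.finite_leaves_at H.finite_leaves_at
    by (auto simp: G.load_def H.load_def intro: finite_same_card_bij)
  then obtain h where h: "\<And>v. v \<in> I \<Longrightarrow> bij_betw (h v) (G.leaves_at v) (H.leaves_at (g v))"
    by metis
  define f where "f x = (if x \<in> I then g x else h (par x) x)" for x
  have f_core: "f v \<in> J" if "v \<in> I" for v
    using that bij_betwE[OF g] by (simp add: f_def)
  have f_leaf: "f l \<in> verts H" "f l \<notin> J" "par' (f l) = g (par l)" if "l \<in> verts G" "l \<notin> I" for l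
  proof -
    have "l \<in> G.leaves_at (par l)" "par l \<in> I" using that G.par_core by (auto simp: G.leaves_at_def)
    then have "f l \<in> H.leaves_at (g (par l))"
      using that bij_betwE[OF h] by (simp add: f_def)
    then show "f l \<in> verts H" "f l \<notin> J" "par' (f l) = g (par l)" by (auto simp: H.leaves_at_def)
  qed
  have g_inj: "g u = g v \<longleftrightarrow> u = v" if "u \<in> I" "v \<in> I" for u v
    using g that by (auto simp: bij_betw_def inj_on_def)
  have "inj_on f (verts G)"
  proof (rule inj_onI)
    fix x y assume xy: "x \<in> verts G" "y \<in> verts G" "f x = f y"
    then have "x \<in> I \<longleftrightarrow> y \<in> I" using f_core f_leaf by metis
    show "x = y"
    proof (cases "x \<in> I")
      case True
      then show ?thesis using \<open>x \<in> I \<longleftrightarrow> y \<in> I\<close> xy g_inj by (auto simp: f_def)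
    next
      case False
      then have "y \<notin> I" using \<open>x \<in> I \<longleftrightarrow> y \<in> I\<close> by simp
      then have "par x \<in> I" "par y \<in> I" "par x = par y"
        using False xy f_leaf G.par_core g_inj by metis+
      moreover from this have "x \<in> G.leaves_at (par x)" "y \<in> G.leaves_at (par x)"
        using False \<open>y \<notin> I\<close> xy by (auto simp: G.leaves_at_def)
      ultimately show ?thesis
        using h[of "par x"] xy False \<open>y \<notin> I\<close> by (auto simp: f_def bij_betw_def inj_on_def)
    qed
  qed
  moreover have "f ` verts G = verts H"
  proof (intro equalityI subsetI)
    fix y assume "y \<in> f ` verts G"
    then show "y \<in> verts H" using f_core f_leaf H.core_subset by blast
  next
    fix y assume y: "y \<in> verts H"
    show "y \<in> f ` verts G"
    proof (cases "y \<in> J")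
      case True
      then obtain x where "x \<in> I" "y = g x" using g by (auto simp: bij_betw_def)
      then show ?thesis using G.core_subset by (auto simp: f_def)
    next
      case False
      then obtain v where v: "v \<in> I" "par' y = g v"
        using H.par_core[OF y] g unfolding bij_betw_def by blast
      then have "y \<in> H.leaves_at (g v)" using False y by (auto simp: H.leaves_at_def)
      then obtain x where "x \<in> G.leaves_at v" "y = h v x" using h[OF v(1)] by (auto simp: bij_betw_def)
      then show ?thesis by (auto simp: f_def G.leaves_at_def)
    qed
  qed
  moreover have "{u, v} \<in> edges G \<longleftrightarrow> {f u, f v} \<in> edges H" if uv: "u \<in> verts G" "v \<in> verts G" for u v
  proof -
    have leaf: "{l, w} \<in> edges G \<longleftrightarrow> {f l, f w} \<in> edges H"
      if l: "l \<in> verts G" "l \<notin> I" and w: "w \<in> verts G" for l w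
    proof -
      have "{f l, f w} \<in> edges H \<longleftrightarrow> f w = g (par l)"
        using f_leaf[OF l] H.leaf_edge by simp
      also have "\<dots> \<longleftrightarrow> w = par l"
      proof (cases "w \<in> I")
        case True
        then show ?thesis using g_inj G.par_core[OF l] by (simp add: f_def)
      next
        case False
        then have "f w \<notin> J" "w \<noteq> par l" "g (par l) \<in> J"
          using f_leaf[OF w] G.par_core[OF l] bij_betwE[OF g] by auto
        then show ?thesis by auto
      qed
      finally show ?thesis using G.leaf_edge[OF l] by simp
    qed
    show ?thesis
    proof (cases "u \<in> I \<and> v \<in> I")
      case True
      then show ?thesis using adj by (simp add: f_def)
    next
      case False
      then show ?thesis using leaf[of u v] leaf[of v u] uv by (auto simp: insert_commute)
    qed
  qed
  ultimately show ?thesis unfolding isomorphic_def bij_betw_def by blast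
qed

section \<open>Cores that are paths or stars\<close>

text \<open>The equivalence makes the path induced: it rules out chords, and for
  \<open>i = j\<close> also loops.\<close>

definition path_core :: "'a set set \<Rightarrow> 'a list \<Rightarrow> bool" where
  "path_core E vs \<longleftrightarrow> distinct vs \<and>
     (\<forall>i<length vs. \<forall>j<length vs. {vs ! i, vs ! j} \<in> E \<longleftrightarrow> j = Suc i \<or> i = Suc j)"

lemma path_core_rev:
  assumes "path_core E vs"
  shows "path_core E (rev vs)"
  using assms by (auto simp: path_core_def rev_nth)

lemma path_core_isomorphic:
  assumes G: "cored_graph G (set vs) par" "path_core (edges G) vs"
    and H: "cored_graph H (set ws) par'" "path_core (edges H) ws"
    and load: "map (cored_graph.load G (set vs) par) vs = map (cored_graph.load H (set ws) par') ws"
  shows "isomorphic G H"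
proof -
  let ?n = "length vs"
  have len: "length ws = ?n" using load by (metis length_map)
  have vs: "bij_betw (nth vs) {..<?n} (set vs)" and ws: "bij_betw (nth ws) {..<?n} (set ws)"
    using G(2) H(2) len by (auto simp: path_core_def intro!: bij_betw_nth)
  define g where "g = nth ws \<circ> the_inv_into {..<?n} (nth vs)"
  have g: "g (vs ! i) = ws ! i" if "i < ?n" for i
    using vs that by (auto simp: g_def the_inv_into_f_f bij_betw_def)
  show ?thesis
  proof (rule cored_graph_isomorphic[OF G(1) H(1)])
    show "bij_betw g (set vs) (set ws)"
      unfolding g_def by (rule bij_betw_trans[OF bij_betw_the_inv_into[OF vs] ws])
    show "{u, v} \<in> edges G \<longleftrightarrow> {g u, g v} \<in> edges H" if "u \<in> set vs" "v \<in> set vs" for u v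
      using that G(2) H(2) len g by (auto simp: in_set_conv_nth path_core_def)
    show "cored_graph.load G (set vs) par v = cored_graph.load H (set ws) par' (g v)"
      if "v \<in> set vs" for v
      using that load g len by (metis in_set_conv_nth nth_map)
  qed
qed

lemma simple_graph_no_loop: "simple_graph G \<Longrightarrow> {v} \<notin> edges G"
  by (auto simp: simple_graph_def)

lemma linked_neighbour:
  "linked E J \<Longrightarrow> v \<in> J \<Longrightarrow> J \<noteq> {v} \<Longrightarrow> \<exists>u\<in>J. u \<noteq> v \<and> {v, u} \<in> E"
  using linked_isolatedD by metis

lemma path_core2_iff:
  assumes "simple_graph G"
  shows "path_core (edges G) [a, b] \<longleftrightarrow> distinct [a, b] \<and> {a, b} \<in> edges G"
  using simple_graph_no_loop[OF assms]
  by (auto simp: path_core_def less_Suc_eq insert_commute)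

lemma path_core3_iff:
  assumes "simple_graph G"
  shows "path_core (edges G) [a, b, c] \<longleftrightarrow>
    distinct [a, b, c] \<and> {a, b} \<in> edges G \<and> {b, c} \<in> edges G \<and> {a, c} \<notin> edges G"
  using simple_graph_no_loop[OF assms]
  by (auto simp: path_core_def less_Suc_eq insert_commute)

lemma path_core4_iff:
  assumes "simple_graph G"
  shows "path_core (edges G) [a, b, c, e] \<longleftrightarrow>
    distinct [a, b, c, e] \<and> {a, b} \<in> edges G \<and> {b, c} \<in> edges G \<and> {c, e} \<in> edges G \<and>
    {a, c} \<notin> edges G \<and> {a, e} \<notin> edges G \<and> {b, e} \<notin> edges G"
  using simple_graph_no_loop[OF assms]
  by (auto simp: path_core_def less_Suc_eq insert_commute)

section \<open>Subtree counts for cores that are paths or stars\<close>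

lemma sum_Pow_insert:
  fixes f :: "'a set \<Rightarrow> 'b :: comm_monoid_add"
  assumes "finite A" "x \<notin> A"
  shows "sum f (Pow (insert x A)) = sum f (Pow A) + (\<Sum>J\<in>Pow A. f (insert x J))"
proof -
  have "inj_on (insert x) (Pow A)" using assms by (intro inj_on_inverseI[of _ "\<lambda>J. J - {x}"]) auto
  moreover have "Pow A \<inter> insert x ` Pow A = {}" using assms by auto
  ultimately show ?thesis
    using assms by (simp add: Pow_insert sum.union_disjoint sum.reindex)
qed

context cored_graph
begin

lemma edge_commute: "{u, v} \<in> edges G \<longleftrightarrow> {v, u} \<in> edges G"
  by (simp add: insert_commute)

lemma linked2_iff: "u \<noteq> v \<Longrightarrow> linked (edges G) {u, v} \<longleftrightarrow> {u, v} \<in> edges G"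
  using linked_isolatedD[of "edges G" "{u, v}" u] linked_insert[OF linked_singleton[of "edges G" v], of v u]
  by auto

lemma num_subtrees_path2:
  assumes path: "path_core (edges G) [a, b]" and I: "I = {a, b}"
  shows "num_subtrees G = load a + load b + 2 ^ load a + 2 ^ load b + 2 ^ (load a + load b)"
proof -
  have *: "a \<noteq> b" "{a, b} \<in> edges G" using path simple by (auto simp: path_core2_iff)
  then have "linked (edges G) {a, b}" by (simp add: linked2_iff)
  with * show ?thesis
    unfolding num_subtrees_cored I by (simp add: sum_Pow_insert linked_singleton)
qed

lemma num_subtrees_path3:
  assumes path: "path_core (edges G) [a, b, c]" and I: "I = {a, b, c}"
  shows "num_subtrees G = load a + load b + load c
    + 2 ^ load a + 2 ^ load b + 2 ^ load c + 2 ^ (load a + load b) + 2 ^ (load b + load c)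
    + 2 ^ (load a + load b + load c)"
proof -
  have *: "distinct [a, b, c]" "{a, b} \<in> edges G" "{b, c} \<in> edges G" "{a, c} \<notin> edges G"
    using path simple by (auto simp: path_core3_iff)
  then have "linked (edges G) {a, b}" "linked (edges G) {b, c}" "\<not> linked (edges G) {a, c}"
    by (simp_all add: linked2_iff)
  moreover from this * have "linked (edges G) {a, b, c}"
    using linked_insert[of "edges G" "{b, c}" b a] by auto
  ultimately show ?thesis
    using * unfolding num_subtrees_cored I
    by (simp add: sum_Pow_insert linked_singleton add_ac)
qed

lemma num_subtrees_path4:
  assumes path: "path_core (edges G) [a, b, c, e]" and I: "I = {a, b, c, e}"
  shows "num_subtrees G = load a + load b + load c + load e
    + 2 ^ load a + 2 ^ load b + 2 ^ load c + 2 ^ load e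
    + 2 ^ (load a + load b) + 2 ^ (load b + load c) + 2 ^ (load c + load e)
    + 2 ^ (load a + load b + load c) + 2 ^ (load b + load c + load e)
    + 2 ^ (load a + load b + load c + load e)"
proof -
  have *: "distinct [a, b, c, e]" "{a, b} \<in> edges G" "{b, c} \<in> edges G" "{c, e} \<in> edges G"
    "{a, c} \<notin> edges G" "{a, e} \<notin> edges G" "{b, e} \<notin> edges G"
    using path simple by (auto simp: path_core4_iff)
  then have 2: "linked (edges G) {a, b}" "linked (edges G) {b, c}" "linked (edges G) {c, e}"
    "\<not> linked (edges G) {a, c}" "\<not> linked (edges G) {a, e}" "\<not> linked (edges G) {b, e}"
    by (simp_all add: linked2_iff)
  have 3: "linked (edges G) {a, b, c}" "linked (edges G) {b, c, e}"
    using * 2 linked_insert[of _ "{b, c}" b a] linked_insert[of _ "{c, e}" c b] by auto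
  then have 4: "linked (edges G) {a, b, c, e}"
    using * linked_insert[of _ "{b, c, e}" b a] by auto
  have "\<not> linked (edges G) {a, b, e}"
    using linked_isolatedD[of "edges G" "{a, b, e}" e] * by (auto simp: edge_commute[of e])
  moreover have "\<not> linked (edges G) {a, c, e}"
    using linked_isolatedD[of "edges G" "{a, c, e}" a] * by auto
  ultimately show ?thesis
    using * 2 3 4 unfolding num_subtrees_cored I
    by (simp add: sum_Pow_insert linked_singleton add_ac)
qed

text \<open>With the centre \<open>a\<close>, every subset of the other three core vertices gives a
  connected part, whence the product; without \<open>a\<close>, only single vertices are
  connected.\<close>

lemma num_subtrees_star4:
  assumes star: "distinct [a, b, c, e]" "{a, b} \<in> edges G" "{a, c} \<in> edges G" "{a, e} \<in> edges G"
    "{b, c} \<notin> edges G" "{b, e} \<notin> edges G" "{c, e} \<notin> edges G"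
    and I: "I = {a, b, c, e}"
  shows "num_subtrees G = load a + load b + load c + load e
    + 2 ^ load b + 2 ^ load c + 2 ^ load e
    + 2 ^ load a * (1 + 2 ^ load b) * (1 + 2 ^ load c) * (1 + 2 ^ load e)"
proof -
  have 2: "linked (edges G) {a, b}" "linked (edges G) {a, c}" "linked (edges G) {a, e}"
    "\<not> linked (edges G) {b, c}" "\<not> linked (edges G) {b, e}" "\<not> linked (edges G) {c, e}"
    using star by (simp_all add: linked2_iff)
  have 3: "linked (edges G) {a, b, c}" "linked (edges G) {a, b, e}" "linked (edges G) {a, c, e}"
    using star 2 linked_insert[of "edges G" "{a, c}" a b] linked_insert[of "edges G" "{a, e}" a b]
      linked_insert[of "edges G" "{a, e}" a c] by (auto simp: insert_commute)
  then have 4: "linked (edges G) {a, b, c, e}"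
    using star linked_insert[of "edges G" "{a, c, e}" a b] by (auto simp: insert_commute)
  have "\<not> linked (edges G) {b, c, e}"
    using linked_isolatedD[of "edges G" "{b, c, e}" b] star by auto
  then show ?thesis
    using star 2 3 4 unfolding num_subtrees_cored I
    by (simp add: sum_Pow_insert linked_singleton algebra_simps power_add)
qed

section \<open>The possible shapes of a core with two, three or four vertices\<close>

lemma core_linked:
  assumes "connected_graph G"
  shows "linked (edges G) I"
  using linked_core_part[of "verts G"] assms core_subset
  by (simp add: connected_graph_iff_linked Int_absorb1)

lemma no_triangle:
  assumes "distinct [x, y, z]" "{x, y} \<in> edges G" "{y, z} \<in> edges G" "{x, z} \<in> edges G"
  shows False
proof -
  have "graph_cycle G [x, y, z]"
    using assms simple_graph_verts[OF simple] by (auto simp: graph_cycle_def walk_def insert_commute)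
  then show False using acyclic by blast
qed

lemma no_square:
  assumes "distinct [w, x, y, z]"
    "{w, x} \<in> edges G" "{x, y} \<in> edges G" "{y, z} \<in> edges G" "{w, z} \<in> edges G"
  shows False
proof -
  have "graph_cycle G [w, x, y, z]"
    using assms simple_graph_verts[OF simple] by (auto simp: graph_cycle_def walk_def insert_commute)
  then show False using acyclic by blast
qed

lemma core2_path:
  assumes "connected_graph G" "card I = 2"
  obtains a b where "I = {a, b}" "path_core (edges G) [a, b]"
proof -
  obtain a b where ab: "I = {a, b}" "a \<noteq> b" using assms by (auto simp: card_2_iff)
  then have "{a, b} \<in> edges G" using core_linked assms linked2_iff by blast
  then show thesis using that ab simple by (auto simp: path_core2_iff)
qed

lemma core3_path:
  assumes "connected_graph G" "card I = 3"
  obtains a b c where "I = {a, b, c}" "path_core (edges G) [a, b, c]"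
proof -
  obtain a b c where abc: "I = {a, b, c}" "distinct [a, b, c]" using assms by (auto simp: card_3_iff)
  have linked: "linked (edges G) {a, b, c}" using core_linked assms abc by simp
  have "{a, b} \<in> edges G \<or> {a, c} \<in> edges G" "{a, b} \<in> edges G \<or> {b, c} \<in> edges G"
    "{a, c} \<in> edges G \<or> {b, c} \<in> edges G"
    using linked_neighbour[OF linked, of a] linked_neighbour[OF linked, of b]
      linked_neighbour[OF linked, of c] abc(2) by (auto simp: insert_commute)
  moreover have "\<not> ({a, b} \<in> edges G \<and> {b, c} \<in> edges G \<and> {a, c} \<in> edges G)"
    using no_triangle abc by blast
  ultimately have "path_core (edges G) [a, b, c] \<or> path_core (edges G) [b, a, c] \<or>
      path_core (edges G) [a, c, b]"
    using abc(2) simple by (auto simp: path_core3_iff insert_commute)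
  then show thesis using that abc(1) by (auto simp: insert_commute)
qed

definition star_core :: "'a \<Rightarrow> 'a \<Rightarrow> 'a \<Rightarrow> 'a \<Rightarrow> bool" where
  "star_core a b c e \<longleftrightarrow>
    distinct [a, b, c, e] \<and> {a, b} \<in> edges G \<and> {a, c} \<in> edges G \<and> {a, e} \<in> edges G \<and>
    {b, c} \<notin> edges G \<and> {b, e} \<notin> edges G \<and> {c, e} \<notin> edges G"

text \<open>A case distinction over the six possible edges. The facts \<open>single\<close> and
  \<open>pairs\<close> express connectedness across all seven cuts of four vertices;
  \<open>triangles\<close> and \<open>squares\<close> exclude all seven possible cycles. What
  survives are the sixteen labelled trees on four vertices: four stars and twelve paths, each path
  listed in one direction.\<close>

lemma core4_shape:
  assumes "connected_graph G" "card I = 4"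
  obtains a b c e where "I = {a, b, c, e}" "path_core (edges G) [a, b, c, e]"
    | a b c e where "I = {a, b, c, e}" "star_core a b c e"
proof -
  have "card I = Suc 3" using assms by simp
  then obtain a J where aJ: "I = insert a J" "a \<notin> J" "card J = 3" unfolding card_Suc_eq by blast
  then obtain b c e where "J = {b, c, e}" "distinct [b, c, e]" by (auto simp: card_3_iff)
  with aJ have I: "I = {a, b, c, e}" and dist: "distinct [a, b, c, e]" by auto
  have linked: "linked (edges G) {a, b, c, e}" using core_linked assms I by simp
  let ?E = "edges G"
  have single: "{a, b} \<in> ?E \<or> {a, c} \<in> ?E \<or> {a, e} \<in> ?E" "{a, b} \<in> ?E \<or> {b, c} \<in> ?E \<or> {b, e} \<in> ?E"
    "{a, c} \<in> ?E \<or> {b, c} \<in> ?E \<or> {c, e} \<in> ?E" "{a, e} \<in> ?E \<or> {b, e} \<in> ?E \<or> {c, e} \<in> ?E"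
    using linked_neighbour[OF linked, of a] linked_neighbour[OF linked, of b]
      linked_neighbour[OF linked, of c] linked_neighbour[OF linked, of e] dist
    by (auto simp: insert_commute)
  have double: "{x, z} \<in> ?E \<or> {x, w} \<in> ?E \<or> {y, z} \<in> ?E \<or> {y, w} \<in> ?E"
    if xyzw: "{x, y, z, w} = {a, b, c, e}" "distinct [x, y, z, w]" for x y z w
  proof -
    have "linked ?E {x, y, z, w}" using linked xyzw by simp
    moreover have "z \<in> {x, y, z, w}" "z \<notin> {x, y}" using xyzw(2) by auto
    ultimately obtain s t where "s \<in> {x, y}" "t \<in> {x, y, z, w}" "t \<notin> {x, y}" "{s, t} \<in> ?E"
      using linkedD[of ?E "{x, y, z, w}" "{x, y}"] by blast
    then show ?thesis by auto
  qed
  have pairs: "{a, c} \<in> ?E \<or> {a, e} \<in> ?E \<or> {b, c} \<in> ?E \<or> {b, e} \<in> ?E"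
    "{a, b} \<in> ?E \<or> {a, e} \<in> ?E \<or> {b, c} \<in> ?E \<or> {c, e} \<in> ?E"
    "{a, b} \<in> ?E \<or> {a, c} \<in> ?E \<or> {b, e} \<in> ?E \<or> {c, e} \<in> ?E"
    using double[of a b c e] double[of a c b e] double[of a e b c] dist
    by (auto simp: insert_commute)
  have triangles: "\<not> ({a, b} \<in> ?E \<and> {b, c} \<in> ?E \<and> {a, c} \<in> ?E)"
    "\<not> ({a, b} \<in> ?E \<and> {b, e} \<in> ?E \<and> {a, e} \<in> ?E)"
    "\<not> ({a, c} \<in> ?E \<and> {c, e} \<in> ?E \<and> {a, e} \<in> ?E)"
    "\<not> ({b, c} \<in> ?E \<and> {c, e} \<in> ?E \<and> {b, e} \<in> ?E)"
    using no_triangle[of a b c] no_triangle[of a b e] no_triangle[of a c e]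
      no_triangle[of b c e] dist by auto
  have squares: "\<not> ({a, b} \<in> ?E \<and> {b, c} \<in> ?E \<and> {c, e} \<in> ?E \<and> {a, e} \<in> ?E)"
    "\<not> ({a, b} \<in> ?E \<and> {b, e} \<in> ?E \<and> {c, e} \<in> ?E \<and> {a, c} \<in> ?E)"
    "\<not> ({a, c} \<in> ?E \<and> {b, c} \<in> ?E \<and> {b, e} \<in> ?E \<and> {a, e} \<in> ?E)"
    using no_square[of a b c e] no_square[of a b e c] no_square[of a c b e] dist
    by (auto simp: insert_commute)
  have "star_core a b c e \<or> star_core b a c e \<or> star_core c a b e \<or> star_core e a b c \<or>
    path_core ?E [a, b, c, e] \<or> path_core ?E [a, b, e, c] \<or> path_core ?E [a, c, b, e] \<or>
    path_core ?E [a, c, e, b] \<or> path_core ?E [a, e, b, c] \<or> path_core ?E [a, e, c, b] \<or>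
    path_core ?E [b, a, c, e] \<or> path_core ?E [b, a, e, c] \<or> path_core ?E [c, a, b, e] \<or>
    path_core ?E [c, a, e, b] \<or> path_core ?E [e, a, b, c] \<or> path_core ?E [e, a, c, b]"
    unfolding star_core_def path_core4_iff[OF simple] edge_commute[of b a] edge_commute[of c a]
      edge_commute[of e a] edge_commute[of c b] edge_commute[of e b] edge_commute[of e c]
    using single pairs triangles squares dist
    by (cases "{a, b} \<in> ?E"; cases "{a, c} \<in> ?E"; cases "{a, e} \<in> ?E";
        cases "{b, c} \<in> ?E"; cases "{b, e} \<in> ?E"; cases "{c, e} \<in> ?E"; simp; blast)
  then show thesis
    by (elim disjE) (rule that; simp add: I insert_commute)+
qed

end

section \<open>Caterpillars and trees with a given degree sequence\<close>

text \<open>The core of the caterpillar consists of \<open>Spine 1\<close> to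
  \<open>Spine k\<close>. The two ends of the spine are leaves and are sent to their only
  neighbours, \<open>Spine 1\<close> and \<open>Spine k\<close>.\<close>

fun spine_parent :: "cat_vertex \<Rightarrow> cat_vertex" where
  "spine_parent (Pendant j i) = Spine j"
| "spine_parent (Spine j) = (if j = 0 then Spine 1 else Spine (j - 1))"

lemma verts_caterpillar:
  "verts (caterpillar ys) = Spine ` {0..length ys + 1} \<union>
     {Pendant j i | j i. j \<in> {1..length ys} \<and> i \<in> {1..ys ! (j - 1)}}"
  by (simp add: caterpillar_def verts_def Let_def)

lemma edge_caterpillar:
  "{Spine i, Spine j} \<in> edges (caterpillar ys) \<longleftrightarrow>
     i \<le> length ys \<and> j = Suc i \<or> j \<le> length ys \<and> i = Suc j"
  "{Spine j, Pendant j' i} \<in> edges (caterpillar ys) \<longleftrightarrow>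
     j = j' \<and> j \<in> {1..length ys} \<and> i \<in> {1..ys ! (j - 1)}"
  "{Pendant j' i, Spine j} \<in> edges (caterpillar ys) \<longleftrightarrow>
     j = j' \<and> j \<in> {1..length ys} \<and> i \<in> {1..ys ! (j - 1)}"
  "{Pendant j i, Pendant j' i'} \<notin> edges (caterpillar ys)"
  by (auto simp: caterpillar_def edges_def Let_def doubleton_eq_iff)

lemma cored_caterpillar:
  assumes "ys \<noteq> []"
  shows "cored_graph (caterpillar ys) (Spine ` {1..length ys}) spine_parent"
proof
  let ?G = "caterpillar ys"
  have "verts ?G = Spine ` {0..length ys + 1} \<union>
     (\<Union>j\<in>{1..length ys}. Pendant j ` {1..ys ! (j - 1)})"
    by (auto simp: verts_caterpillar)
  then have "finite (verts ?G)" by simp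
  then show "simple_graph ?G"
    by (auto simp: simple_graph_def caterpillar_def edges_def verts_def Let_def)
  \<comment> \<open>Spine vertices are ranked by position and pendant vertices above all their
    neighbours. So \<open>Spine j\<close> has at most \<open>Spine (j - 1)\<close> below it, and a
    pendant vertex has just one neighbour.\<close>
  define r where "r = case_cat_vertex (\<lambda>j. j) (\<lambda>_ _. length ys + 1)"
  show "\<nexists>p. graph_cycle ?G p"
  proof (rule acyclicI_rank[where r = r])
    fix v u w assume "{v, u} \<in> edges ?G" "{v, w} \<in> edges ?G" "r u \<le> r v" "r w \<le> r v"
    then show "u = w"
      by (cases v; cases u; cases w) (auto simp: edge_caterpillar r_def)
  qed
  show "Spine ` {1..length ys} \<subseteq> verts ?G" by (auto simp: verts_caterpillar)
  fix l assume l: "l \<in> verts ?G" "l \<notin> Spine ` {1..length ys}"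
  have ends: "j = 0 \<or> j = Suc (length ys)" if "l = Spine j" for j
    using l that by (auto simp: verts_caterpillar image_iff)
  have len: "0 < length ys" using assms by simp
  show "spine_parent l \<in> Spine ` {1..length ys}"
  proof (cases l)
    case (Spine j)
    then show ?thesis using ends[OF Spine] len by (auto simp: image_iff Suc_le_eq)
  next
    case (Pendant j i)
    then show ?thesis using l by (auto simp: verts_caterpillar)
  qed
  show "{l, u} \<in> edges ?G \<longleftrightarrow> u = spine_parent l" for u
  proof (cases l)
    case (Spine j)
    then show ?thesis using ends[OF Spine] len by (cases u) (auto simp: edge_caterpillar)
  next
    case (Pendant j i)
    then show ?thesis using l by (cases u) (auto simp: edge_caterpillar verts_caterpillar)
  qed
qed

text \<open>The corrections account for \<open>Spine 0\<close> and the last spine vertex, which are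
  leaves at the first and last core vertex; both apply when the core is a single vertex.\<close>

lemma load_caterpillar:
  assumes "ys \<noteq> []" "1 \<le> j" "j \<le> length ys"
  shows "cored_graph.load (caterpillar ys) (Spine ` {1..length ys}) spine_parent (Spine j) =
    ys ! (j - 1) + (if j = 1 then 1 else 0) + (if j = length ys then 1 else 0)"
proof -
  interpret cored_graph "caterpillar ys" "Spine ` {1..length ys}" spine_parent
    by (rule cored_caterpillar) fact
  have "leaves_at (Spine j) = Pendant j ` {1..ys ! (j - 1)} \<union>
      ((if j = 1 then {Spine 0} else {}) \<union> (if j = length ys then {Spine (length ys + 1)} else {}))"
    unfolding leaves_at_def verts_caterpillar using assms
    by (auto simp: image_iff split: if_splits)
  moreover have "card (Pendant j ` {1..ys ! (j - 1)}) = ys ! (j - 1)"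
    by (simp add: card_image inj_on_def)
  ultimately show ?thesis
    unfolding load_def by (auto simp: card_Un_disjoint card_insert_if)
qed

lemma path_core_caterpillar:
  "path_core (edges (caterpillar ys)) (map Spine [1..<Suc (length ys)])"
proof -
  have "map Spine [1..<Suc (length ys)] ! i = Spine (Suc i)" if "i < length ys" for i
    using that by (simp del: upt_Suc)
  moreover have "distinct (map Spine [1..<Suc (length ys)])"
    by (simp add: distinct_map inj_on_def del: upt_Suc)
  ultimately show ?thesis by (auto simp: path_core_def edge_caterpillar simp del: upt_Suc)
qed

text \<open>A vertex outside \<open>I\<close> has degree one, which defines \<open>par\<close>. Were
  its neighbour outside \<open>I\<close> too, the two would form a component of their own, which
  connectedness forbids because \<open>I\<close> supplies a third vertex.\<close>

lemma tree_cored: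
  assumes tree: "tree T" and I: "I = {v \<in> verts T. 2 \<le> degree T v}" "2 \<le> card I"
    and pos: "\<And>v. v \<in> verts T \<Longrightarrow> 1 \<le> degree T v"
  obtains par where "cored_graph T I par"
proof -
  have simple: "simple_graph T" and acyclic: "\<nexists>p. graph_cycle T p"
    and linked: "linked (edges T) (verts T)"
    using tree by (auto simp: tree_def connected_graph_iff_linked)
  have "\<exists>u. \<forall>w. {l, w} \<in> edges T \<longleftrightarrow> w = u" if l: "l \<in> verts T - I" for l
  proof -
    have "degree T l = 1" using l pos[of l] I by fastforce
    then obtain e where e: "{e \<in> edges T. l \<in> e} = {e}" by (auto simp: degree_def card_1_singleton_iff)
    then have "card e = 2" "l \<in> e" using simple by (auto simp: simple_graph_def)
    then obtain u where u: "e = {l, u}" "u \<noteq> l" by (auto simp: card_2_iff insert_commute)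
    have "{l, w} \<in> edges T \<longleftrightarrow> w = u" for w
    proof
      assume "{l, w} \<in> edges T"
      then have "{l, w} \<in> {e \<in> edges T. l \<in> e}" by simp
      then have "{l, w} = {l, u}" using e u by simp
      then show "w = u" using u by (auto simp: doubleton_eq_iff)
    next
      assume "w = u"
      then show "{l, w} \<in> edges T" using e u by blast
    qed
    then show ?thesis by blast
  qed
  then obtain par where par: "\<And>l w. l \<in> verts T - I \<Longrightarrow> {l, w} \<in> edges T \<longleftrightarrow> w = par l"
    by metis
  have par_core: "par l \<in> I" if l: "l \<in> verts T - I" for l
  proof (rule ccontr)
    assume "par l \<notin> I"
    have edge: "{l, par l} \<in> edges T" using par[OF l] by simp
    then have "par l \<in> verts T - I" using simple_graph_verts[OF simple edge] \<open>par l \<notin> I\<close> by simp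
    then have "par (par l) = l" using par[of "par l" l] edge by (simp add: insert_commute)
    have "I \<noteq> {}" using I(2) by auto
    then obtain z where "z \<in> I" "z \<in> verts T" using I(1) by blast
    moreover have "z \<notin> {l, par l}" using \<open>z \<in> I\<close> l \<open>par l \<notin> I\<close> by blast
    ultimately have "{l, par l} \<noteq> verts T" by metis
    then obtain x y where xy: "x \<in> {l, par l}" "y \<in> verts T" "y \<notin> {l, par l}" "{x, y} \<in> edges T"
      using linkedD[OF linked, of "{l, par l}"] l \<open>par l \<in> verts T - I\<close> by auto
    then have "y = par x" using par[of x y] l \<open>par l \<in> verts T - I\<close> by auto
    then show False using xy \<open>par (par l) = l\<close> by auto
  qed
  have "cored_graph T I par"
    by unfold_locales (use simple acyclic I par par_core in auto)
  then show thesis using that by blast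
qed

text \<open>Keeping only the entries that are at least two on both sides of the multiset equation
  leaves the internal vertices on one side and the indices up to \<open>k\<close> on the other;
  comparing sizes gives \<open>card I = k\<close>. Each degree occurs among the \<open>d i\<close>,
  so none is zero.\<close>

lemma degree_sequence_core:
  assumes T: "T \<in> trees_with_degrees n d" and k: "2 \<le> k" "k \<le> n"
    and core: "\<forall>i\<in>{1..k}. 2 \<le> d i" and leaves: "\<forall>i\<in>{k<..n}. d i = 1"
  obtains I par where "cored_graph T I par" "connected_graph T" "card I = k" "card (verts T) = n"
    "image_mset (degree T) (mset_set I) = image_mset d (mset_set {1..k})"
    "\<And>v. v \<in> I \<Longrightarrow> 2 \<le> degree T v"
proof -
  define I where "I = {v \<in> verts T. 2 \<le> degree T v}"
  have tree: "tree T" and deg: "image_mset (degree T) (mset_set (verts T)) = image_mset d (mset_set {1..n})"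
    using T by (auto simp: trees_with_degrees_def has_degree_sequence_def)
  have fin: "finite (verts T)" using tree by (simp add: tree_def simple_graph_def)
  have card: "card (verts T) = n" using arg_cong[OF deg, of size] by simp
  have "image_mset (degree T) (mset_set I) = filter_mset (\<lambda>x. 2 \<le> x) (image_mset (degree T) (mset_set (verts T)))"
    using fin by (simp add: I_def filter_mset_image_mset)
  also have "\<dots> = filter_mset (\<lambda>x. 2 \<le> x) (image_mset d (mset_set {1..n}))" by (simp add: deg)
  also have "\<dots> = image_mset d (mset_set {i \<in> {1..n}. 2 \<le> d i})" by (simp add: filter_mset_image_mset)
  also have "{i \<in> {1..n}. 2 \<le> d i} = {1..k}"
  proof (intro equalityI subsetI)
    fix i assume "i \<in> {i \<in> {1..n}. 2 \<le> d i}"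
    then show "i \<in> {1..k}" using leaves by (cases "k < i") auto
  qed (use k core in auto)
  finally have coredeg: "image_mset (degree T) (mset_set I) = image_mset d (mset_set {1..k})" .
  have cardI: "card I = k" using arg_cong[OF coredeg, of size] by simp
  have pos: "1 \<le> degree T v" if "v \<in> verts T" for v
  proof -
    have "degree T v \<in># image_mset (degree T) (mset_set (verts T))" using that fin by auto
    then obtain i where "i \<in> {1..n}" "degree T v = d i" unfolding deg by auto
    then show ?thesis using core leaves by (cases "k < i") force+
  qed
  obtain par where "cored_graph T I par"
    using tree_cored[OF tree I_def _ pos] cardI k by auto
  then show thesis
    using tree card cardI coredeg by (intro that[of I par]) (simp_all add: tree_def I_def)
qed

section \<open>The weight inequalities\<close>

lemma mset2_eqD:
  "{#x, y#} = {#a, b#} \<Longrightarrow> x = a \<and> y = b \<or> x = b \<and> y = a"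
  by (metis add_mset_eq_single add_mset_eq_singleton_iff add_eq_conv_ex)

lemma mset3_eqD:
  assumes "{#x, y, z#} = {#a, b, c#}"
  shows "x = a \<and> {#y, z#} = {#b, c#} \<or> x = b \<and> {#y, z#} = {#a, c#} \<or> x = c \<and> {#y, z#} = {#a, b#}"
proof -
  have "x \<in># {#a, b, c#}" unfolding assms[symmetric] by simp
  then consider "x = a" | "x = b" | "x = c" by auto
  then show ?thesis using assms by cases (auto simp: add_mset_commute)
qed

lemma mset4_eqD:
  assumes "{#x, y, z, w#} = {#a, b, c, e#}"
  shows "x = a \<and> {#y, z, w#} = {#b, c, e#} \<or> x = b \<and> {#y, z, w#} = {#a, c, e#} \<or>
    x = c \<and> {#y, z, w#} = {#a, b, e#} \<or> x = e \<and> {#y, z, w#} = {#a, b, c#}"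
proof -
  have "x \<in># {#a, b, c, e#}" unfolding assms[symmetric] by simp
  then consider "x = a" | "x = b" | "x = c" | "x = e" by auto
  then show ?thesis using assms by cases (auto simp: add_mset_commute)
qed

text \<open>For a caterpillar \<open>C(y\<^sub>1, \<dots>, y\<^sub>k)\<close> these are the numbers of subtrees with at least one
  internal vertex, in terms of the powers \<open>2\<close> to the \<open>y\<^sub>i\<close>; the end vertices carry one
  additional leaf, whence the factors \<open>2\<close>.\<close>

definition weight3 :: "nat \<Rightarrow> nat \<Rightarrow> nat \<Rightarrow> nat" where
  "weight3 p q r = 2 * p + q + 2 * r + 2 * p * q + 2 * q * r + 4 * p * q * r"

definition weight4 :: "nat \<Rightarrow> nat \<Rightarrow> nat \<Rightarrow> nat \<Rightarrow> nat" where
  "weight4 p q r s = 2 * p + q + r + 2 * s + 2 * p * q + q * r + 2 * r * s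
     + 2 * p * q * r + 2 * q * r * s + 4 * p * q * r * s"

lemma weight3_rev: "weight3 r q p = weight3 p q r"
  by (simp add: weight3_def algebra_simps)

lemma weight4_rev: "weight4 s r q p = weight4 p q r s"
  by (simp add: weight4_def algebra_simps)

text \<open>All terms symmetric in \<open>p\<close> and \<open>q\<close> cancel, and the difference
  factors as \<open>(q - p) * (2 * r - 1)\<close>. The computation takes place in the integers to
  avoid truncated subtraction.\<close>

lemma weight3_swap:
  assumes "p < q" "1 \<le> r"
  shows "weight3 q p r < weight3 p q r"
proof -
  have "int (weight3 p q r) - int (weight3 q p r) = (int q - int p) * (2 * int r - 1)"
    by (simp add: weight3_def algebra_simps)
  moreover have "0 < (int q - int p) * (2 * int r - 1)" using assms by simp
  ultimately show ?thesis by linarith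
qed

text \<open>Exchanges an end with its inner neighbour; the other end follows by reversal.\<close>

lemma weight4_swap_ends:
  assumes "p < q" "1 \<le> r" "1 \<le> s"
  shows "weight4 q p r s < weight4 p q r s"
proof -
  have "int (weight4 p q r s) - int (weight4 q p r s) =
      (int q - int p) * (int r + 2 * (int r * int s) - 1)"
    by (simp add: weight4_def algebra_simps)
  moreover have "0 < int r * int s" using assms by simp
  then have "0 < (int q - int p) * (int r + 2 * (int r * int s) - 1)"
    using assms by (intro mult_pos_pos) linarith+
  ultimately show ?thesis by linarith
qed

text \<open>Exchanges the second vertex with the end at distance two from it. With
  \<open>weight4_swap_ends\<close> and reversal, every pair of an end and an inner vertex is
  covered.\<close>

lemma weight4_swap_middle:
  assumes "s < q" "1 \<le> p"
  shows "weight4 p s r q < weight4 p q r s"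
proof -
  have "int (weight4 p q r s) - int (weight4 p s r q) =
      (int q - int s) * (2 * int p - 1) * (1 + int r)"
    by (simp add: weight4_def algebra_simps)
  moreover have "0 < (int q - int s) * (2 * int p - 1) * (1 + int r)"
    using assms by (intro mult_pos_pos) auto
  ultimately show ?thesis by linarith
qed

text \<open>Induction on the weight itself: an exchange strictly lowers it and keeps the multiset.
  An arrangement that admits an exchange therefore lies strictly above the minimum and cannot attain
  equality.\<close>

lemma weight3_min:
  assumes "{#p, q, r#} = {#a, b, c#}" "c \<le> b" "b \<le> a" "1 \<le> c"
  shows "weight3 a c b \<le> weight3 p q r \<and>
    (weight3 p q r = weight3 a c b \<longrightarrow> [p, q, r] = [a, c, b] \<or> [p, q, r] = [b, c, a])"
  using assms(1)
proof (induction "weight3 p q r" arbitrary: p q r rule: less_induct)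
  case less
  have pos: "1 \<le> x" if "x \<in># {#p, q, r#}" for x
    using that unfolding less(2) using assms by auto
  consider "p < q" | "r < q" | "q \<le> p" "q \<le> r" by linarith
  then show ?case
  proof cases
    case 1
    then have "weight3 q p r < weight3 p q r" using pos by (intro weight3_swap) auto
    then show ?thesis using less(1)[of q p r] less(2) by (auto simp: add_mset_commute)
  next
    case 2
    then have "weight3 p r q < weight3 p q r"
      using weight3_swap[of r q p] pos by (simp add: weight3_rev)
    then show ?thesis using less(1)[of p r q] less(2) by (auto simp: add_mset_commute)
  next
    case 3
    \<comment> \<open>Both ends are at least the middle entry, so the middle one is \<open>c\<close>
      and only the direction remains open.\<close>
    have "[p, q, r] = [a, c, b] \<or> [p, q, r] = [b, c, a]"
      using mset3_eqD[OF less(2)] 3 assms by (auto dest!: mset2_eqD)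
    then show ?thesis by (auto simp: weight3_rev)
  qed
qed

lemma weight4_min:
  assumes "{#p, q, r, s#} = {#a, b, c, e#}" "e \<le> c" "c \<le> b" "b \<le> a" "1 \<le> e"
  shows "weight4 a e c b \<le> weight4 p q r s \<and>
    (weight4 p q r s = weight4 a e c b \<longrightarrow> [p, q, r, s] = [a, e, c, b] \<or> [p, q, r, s] = [b, c, e, a])"
  using assms(1)
proof (induction "weight4 p q r s" arbitrary: p q r s rule: less_induct)
  case less
  have pos: "1 \<le> x" if "x \<in># {#p, q, r, s#}" for x
    using that unfolding less(2) using assms by auto
  \<comment> \<open>The first four cases are the four pairs of an end and an inner entry in the
    wrong order. In the last case the two largest values occupy the ends.\<close>
  consider "p < q" | "s < r" | "s < q" | "p < r" | "q \<le> p" "r \<le> p" "q \<le> s" "r \<le> s" by linarith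
  then show ?case
  proof cases
    case 1
    then have "weight4 q p r s < weight4 p q r s" using pos by (intro weight4_swap_ends) auto
    then show ?thesis using less(1)[of q p r s] less(2) by (auto simp: add_mset_commute)
  next
    case 2
    then have "weight4 p q s r < weight4 p q r s"
      using weight4_swap_ends[of s r q p] pos by (simp add: weight4_rev)
    then show ?thesis using less(1)[of p q s r] less(2) by (auto simp: add_mset_commute)
  next
    case 3
    then have "weight4 p s r q < weight4 p q r s" using pos by (intro weight4_swap_middle) auto
    then show ?thesis using less(1)[of p s r q] less(2) by (auto simp: add_mset_commute)
  next
    case 4
    then have "weight4 r q p s < weight4 p q r s"
      using weight4_swap_middle[of p r s q] pos by (simp add: weight4_rev)
    then show ?thesis using less(1)[of r q p s] less(2) by (auto simp: add_mset_commute)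
  next
    case 5
    have "(p = a \<and> s = b \<or> p = b \<and> s = a) \<and> (q = c \<and> r = e \<or> q = e \<and> r = c)"
      using mset4_eqD[OF less(2)] 5 assms by (auto dest!: mset3_eqD mset2_eqD)
    then consider "[p, q, r, s] = [a, e, c, b] \<or> [p, q, r, s] = [b, c, e, a]"
      | "[p, q, r, s] = [b, e, c, a] \<or> [p, q, r, s] = [a, c, e, b]" by auto
    then show ?thesis
    proof cases
      case 1
      then show ?thesis by (auto simp: weight4_rev)
    next
      case 2
      \<comment> \<open>Up to reversal this is the only competitor left. Equality of the weights
        forces \<open>a = b\<close> or \<open>c = e\<close>, and then the competitor coincides with
        one of the two permitted lists, so ties do not spoil uniqueness.\<close>
      have diff: "int (weight4 b e c a) - int (weight4 a e c b) = 2 * ((int a - int b) * (int c - int e))"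
        by (simp add: weight4_def algebra_simps)
      have "0 \<le> (int a - int b) * (int c - int e)" using assms by simp
      with diff have "weight4 a e c b \<le> weight4 b e c a" by linarith
      moreover have "a = b \<or> c = e" if "weight4 b e c a = weight4 a e c b"
        using diff that by simp
      ultimately show ?thesis using 2 weight4_rev[of a c e b] by auto
    qed
  qed
qed

text \<open>The path \<open>x - c - y - z\<close> has the same degrees as the star with centre \<open>c\<close>; the vertex \<open>c\<close>
  carries one more leaf on the path than in the star, whence the factor \<open>2\<close>.\<close>

lemma star_weight_gt:
  assumes "y \<le> x" "1 \<le> c" "1 \<le> z"
  shows "weight4 x (2 * c) y z <
    2 * x + 2 * y + 2 * z + c * (1 + 2 * x) * (1 + 2 * y) * (1 + 2 * z)"
proof -
  have "int (2 * x + 2 * y + 2 * z + c * (1 + 2 * x) * (1 + 2 * y) * (1 + 2 * z))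
      - int (weight4 x (2 * c) y z) = (2 * int z - 1) * (int c * (2 * int x + 1) - int y)"
    by (simp add: weight4_def algebra_simps)
  \<comment> \<open>This is where \<open>y \<le> x\<close> enters: the larger of the two values must
    stand at the end next to the former centre.\<close>
  moreover have "int y < int c * (2 * int x + 1)"
  proof -
    have "int y < 1 * (2 * int x + 1)" using assms by simp
    also have "\<dots> \<le> int c * (2 * int x + 1)" using assms by (intro mult_right_mono) auto
    finally show ?thesis .
  qed
  then have "0 < (2 * int z - 1) * (int c * (2 * int x + 1) - int y)"
    using assms by (intro mult_pos_pos) auto
  ultimately show ?thesis by linarith
qed

section \<open>Trees with at most four internal vertices\<close>

context cored_graph
begin

text \<open>The parameters are degrees minus two, the entries of a caterpillar, instead of loads.
  The summand \<open>2\<close> counts the additional leaf at each of the two ends.\<close>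

lemma num_subtrees_path3_weight:
  assumes "path_core (edges G) [u, v, w]" "I = {u, v, w}" "map load [u, v, w] = [x + 1, y, z + 1]"
  shows "num_subtrees G = x + y + z + 2 + weight3 (2 ^ x) (2 ^ y) (2 ^ z)"
  using num_subtrees_path3[OF assms(1,2)] assms(3)
  by (simp add: weight3_def power_add algebra_simps)

lemma num_subtrees_path4_weight:
  assumes "path_core (edges G) [t, u, v, w]" "I = {t, u, v, w}"
    "map load [t, u, v, w] = [x0 + 1, x1, x2, x3 + 1]"
  shows "num_subtrees G = x0 + x1 + x2 + x3 + 2 + weight4 (2 ^ x0) (2 ^ x1) (2 ^ x2) (2 ^ x3)"
  using num_subtrees_path4[OF assms(1,2)] assms(3)
  by (simp add: weight4_def power_add algebra_simps)

lemma degree_path2: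
  assumes "path_core (edges G) [u, v]" "I = {u, v}"
  shows "degree G u = load u + 1" "degree G v = load v + 1"
proof -
  have *: "u \<noteq> v" "{u, v} \<in> edges G" using assms(1) simple by (simp_all add: path_core2_iff)
  then have "{x \<in> I. {x, u} \<in> edges G} = {v}" "{x \<in> I. {x, v} \<in> edges G} = {u}"
    using assms(2) simple_graph_no_loop[OF simple] by (auto simp: insert_commute)
  then show "degree G u = load u + 1" "degree G v = load v + 1"
    using assms(2) by (simp_all add: degree_core)
qed

lemma degree_path3:
  assumes "path_core (edges G) [u, v, w]" "I = {u, v, w}"
  shows "degree G u = load u + 1" "degree G v = load v + 2" "degree G w = load w + 1"
proof -
  have *: "distinct [u, v, w]" "{u, v} \<in> edges G" "{v, w} \<in> edges G" "{u, w} \<notin> edges G"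
    using assms(1) simple by (simp_all add: path_core3_iff)
  then have "{x \<in> I. {x, u} \<in> edges G} = {v}" "{x \<in> I. {x, v} \<in> edges G} = {u, w}"
    "{x \<in> I. {x, w} \<in> edges G} = {v}"
    using assms(2) simple_graph_no_loop[OF simple] by (auto simp: insert_commute)
  then show "degree G u = load u + 1" "degree G v = load v + 2" "degree G w = load w + 1"
    using assms(2) * by (simp_all add: degree_core)
qed

lemma degree_path4:
  assumes "path_core (edges G) [t, u, v, w]" "I = {t, u, v, w}"
  shows "degree G t = load t + 1" "degree G u = load u + 2" "degree G v = load v + 2"
    "degree G w = load w + 1"
proof -
  have *: "distinct [t, u, v, w]" "{t, u} \<in> edges G" "{u, v} \<in> edges G" "{v, w} \<in> edges G"
    "{t, v} \<notin> edges G" "{t, w} \<notin> edges G" "{u, w} \<notin> edges G"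
    using assms(1) simple by (simp_all add: path_core4_iff)
  then have "{x \<in> I. {x, t} \<in> edges G} = {u}" "{x \<in> I. {x, u} \<in> edges G} = {t, v}"
    "{x \<in> I. {x, v} \<in> edges G} = {u, w}" "{x \<in> I. {x, w} \<in> edges G} = {v}"
    using assms(2) simple_graph_no_loop[OF simple] by (auto simp: insert_commute)
  then show "degree G t = load t + 1" "degree G u = load u + 2" "degree G v = load v + 2"
    "degree G w = load w + 1"
    using assms(2) * by (simp_all add: degree_core)
qed

lemma degree_star4:
  assumes "star_core t u v w" "I = {t, u, v, w}"
  shows "degree G t = load t + 3" "degree G u = load u + 1" "degree G v = load v + 1"
    "degree G w = load w + 1"
proof -
  have "{x \<in> I. {x, t} \<in> edges G} = {u, v, w}" "{x \<in> I. {x, u} \<in> edges G} = {t}"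
    "{x \<in> I. {x, v} \<in> edges G} = {t}" "{x \<in> I. {x, w} \<in> edges G} = {t}"
    using assms simple_graph_no_loop[OF simple] by (auto simp: insert_commute star_core_def)
  then show "degree G t = load t + 3" "degree G u = load u + 1" "degree G v = load v + 1"
    "degree G w = load w + 1"
    using assms by (simp_all add: degree_core star_core_def)
qed

text \<open>Each outer core vertex has one core neighbour, so its load is its degree minus one. With
  \<open>x1\<close>, \<open>x2\<close>, \<open>x3\<close> standing for degrees minus two, this gives
  three additional leaves and the factors \<open>2\<close>.\<close>

lemma num_subtrees_star4_weight:
  assumes "star_core t u v w" "I = {t, u, v, w}"
    and load: "map load [t, u, v, w] = [x0, x1 + 1, x2 + 1, x3 + 1]"
  shows "num_subtrees G = x0 + x1 + x2 + x3 + 3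
    + (2 * 2 ^ x1 + 2 * 2 ^ x2 + 2 * 2 ^ x3
       + 2 ^ x0 * (1 + 2 * 2 ^ x1) * (1 + 2 * 2 ^ x2) * (1 + 2 * 2 ^ x3))"
  using num_subtrees_star4[of t u v w] assms by (simp add: star_core_def)

lemma card_verts: "card (verts G) = card I + sum load I"
  using card_leaves core_subset finite_verts finite_core
  by (metis card_Diff_subset card_mono le_add_diff_inverse)

end

section \<open>Caterpillars with three or four core vertices\<close>

lemma cored_caterpillar3: "cored_graph (caterpillar [x, y, z]) {Spine 1, Spine 2, Spine 3} spine_parent"
  and path_core_caterpillar3: "path_core (edges (caterpillar [x, y, z])) [Spine 1, Spine 2, Spine 3]"
  and load_caterpillar3:
    "map (cored_graph.load (caterpillar [x, y, z]) {Spine 1, Spine 2, Spine 3} spine_parent)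
      [Spine 1, Spine 2, Spine 3] = [x + 1, y, z + 1]"
proof -
  have I: "Spine ` {1..length [x, y, z]} = {Spine 1, Spine 2, Spine 3}"
    by (auto simp: image_iff)
  show "cored_graph (caterpillar [x, y, z]) {Spine 1, Spine 2, Spine 3} spine_parent"
    using cored_caterpillar[of "[x, y, z]"] unfolding I by simp
  show "path_core (edges (caterpillar [x, y, z])) [Spine 1, Spine 2, Spine 3]"
    using path_core_caterpillar[of "[x, y, z]"] by (simp add: upt_rec numeral_3_eq_3 numeral_2_eq_2)
  show "map (cored_graph.load (caterpillar [x, y, z]) {Spine 1, Spine 2, Spine 3} spine_parent)
      [Spine 1, Spine 2, Spine 3] = [x + 1, y, z + 1]"
    using load_caterpillar[of "[x, y, z]", unfolded I] by simp
qed

lemma cored_caterpillar4: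
    "cored_graph (caterpillar [x, y, z, w]) {Spine 1, Spine 2, Spine 3, Spine 4} spine_parent"
  and path_core_caterpillar4:
    "path_core (edges (caterpillar [x, y, z, w])) [Spine 1, Spine 2, Spine 3, Spine 4]"
  and load_caterpillar4:
    "map (cored_graph.load (caterpillar [x, y, z, w]) {Spine 1, Spine 2, Spine 3, Spine 4} spine_parent)
      [Spine 1, Spine 2, Spine 3, Spine 4] = [x + 1, y, z, w + 1]"
proof -
  have I: "Spine ` {1..length [x, y, z, w]} = {Spine 1, Spine 2, Spine 3, Spine 4}"
    by (auto simp: image_iff)
  show "cored_graph (caterpillar [x, y, z, w]) {Spine 1, Spine 2, Spine 3, Spine 4} spine_parent"
    using cored_caterpillar[of "[x, y, z, w]"] unfolding I by simp
  show "path_core (edges (caterpillar [x, y, z, w])) [Spine 1, Spine 2, Spine 3, Spine 4]"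
    using path_core_caterpillar[of "[x, y, z, w]"] by (simp add: upt_rec eval_nat_numeral)
  show "map (cored_graph.load (caterpillar [x, y, z, w]) {Spine 1, Spine 2, Spine 3, Spine 4} spine_parent)
      [Spine 1, Spine 2, Spine 3, Spine 4] = [x + 1, y, z, w + 1]"
    using load_caterpillar[of "[x, y, z, w]", unfolded I] by simp
qed

lemma num_subtrees_caterpillar3:
  "num_subtrees (caterpillar [x, y, z]) = x + y + z + 2 + weight3 (2 ^ x) (2 ^ y) (2 ^ z)"
  using cored_graph.num_subtrees_path3_weight[OF cored_caterpillar3 path_core_caterpillar3 refl
      load_caterpillar3] .

lemma num_subtrees_caterpillar4:
  "num_subtrees (caterpillar [x, y, z, w]) =
     x + y + z + w + 2 + weight4 (2 ^ x) (2 ^ y) (2 ^ z) (2 ^ w)"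
  using cored_graph.num_subtrees_path4_weight[OF cored_caterpillar4 path_core_caterpillar4 refl
      load_caterpillar4] .

lemma cored_isomorphic_num_subtrees:
  assumes "cored_graph G I par" "cored_graph H J par'" "isomorphic G H"
  shows "num_subtrees G = num_subtrees H"
  using assms by (intro isomorphic_num_subtrees) (simp_all add: cored_graph_def)

text \<open>The core is a single edge, so each load is a degree minus one, and the loads add up to
  \<open>n - 2\<close>. The count is symmetric in the two loads, hence the order in which the
  degrees are assigned is immaterial.\<close>

lemma two_internal:
  assumes T: "T \<in> trees_with_degrees n d" and n: "2 \<le> n"
    and core: "\<forall>i\<in>{1..2}. 2 \<le> d i" and leaves: "\<forall>i\<in>{2<..n}. d i = 1"
  shows "num_subtrees T = 2 ^ (n - 2) + 2 ^ (d 1 - 1) + 2 ^ (d 2 - 1) + n - 2"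
proof -
  obtain I par where I: "cored_graph T I par" "connected_graph T" "card I = 2" "card (verts T) = n"
      "image_mset (degree T) (mset_set I) = image_mset d (mset_set {1..2})"
    by (rule degree_sequence_core[OF T order_refl n core leaves])
  interpret cored_graph T I par by (fact I(1))
  obtain u v where uv: "I = {u, v}" "path_core (edges T) [u, v]" using core2_path I by metis
  then have "u \<noteq> v" by (simp add: path_core_def)
  have "{1..2::nat} = {1, 2}" by auto
  then have "{#degree T u, degree T v#} = {#d 1, d 2#}" using I(5) uv(1) \<open>u \<noteq> v\<close> by simp
  then have "{#load u + 1, load v + 1#} = {#d 1, d 2#}" using degree_path2[OF uv(2,1)] by simp
  then have "d 1 = load u + 1 \<and> d 2 = load v + 1 \<or> d 1 = load v + 1 \<and> d 2 = load u + 1"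
    by (auto dest!: mset2_eqD)
  moreover have "n = 2 + load u + load v" using card_verts I uv(1) \<open>u \<noteq> v\<close> by simp
  ultimately show ?thesis
    using num_subtrees_path2[OF uv(2,1)] by auto
qed

text \<open>The relation between \<open>n\<close> and the degrees comes from counting vertices as
  core plus leaves; the closed formula for \<open>C\<close> depends on it.\<close>

lemma three_internal:
  assumes T: "T \<in> trees_with_degrees n d" and n: "3 \<le> n"
    and core: "\<forall>i\<in>{1..3}. 2 \<le> d i" and leaves: "\<forall>i\<in>{3<..n}. d i = 1"
    and mono: "d 2 \<le> d 1" "d 3 \<le> d 2"
    and C: "C = caterpillar [d 1 - 2, d 3 - 2, d 2 - 2]"
  shows "n + 1 = d 1 + d 2 + d 3" "num_subtrees C \<le> num_subtrees T"
    "num_subtrees T = num_subtrees C \<longleftrightarrow> isomorphic T C"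
proof -
  obtain I par where I: "cored_graph T I par" "connected_graph T" "card I = 3" "card (verts T) = n"
      "image_mset (degree T) (mset_set I) = image_mset d (mset_set {1..3})"
      "\<And>v. v \<in> I \<Longrightarrow> 2 \<le> degree T v"
    by (rule degree_sequence_core[OF T _ n core leaves]) simp_all
  interpret cored_graph T I par by (fact I(1))
  obtain u v w where uvw: "I = {u, v, w}" "path_core (edges T) [u, v, w]" using core3_path I by metis
  then have dist: "distinct [u, v, w]" by (simp add: path_core_def)
  define x y z where "x = degree T u - 2" and "y = degree T v - 2" and "z = degree T w - 2"
  have "2 \<le> degree T u" "2 \<le> degree T v" "2 \<le> degree T w" using I(6) uvw(1) by auto
  then have deg: "degree T u = x + 2" "degree T v = y + 2" "degree T w = z + 2"
    by (simp_all add: x_def y_def z_def)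
  then have load: "map load [u, v, w] = [x + 1, y, z + 1]" using degree_path3[OF uvw(2,1)] by simp
  have d: "2 \<le> d 1" "2 \<le> d 2" "2 \<le> d 3" using core by auto
  have "{1..3::nat} = {1, 2, 3}" by auto
  then have "{#x + 2, y + 2, z + 2#} = {#d 1, d 2, d 3#}" using I(5) uvw(1) dist deg by simp
  \<comment> \<open>Subtracting two from each degree yields the caterpillar entries, still as a
    multiset: the order along the path is unknown.\<close>
  then have mset: "{#x, y, z#} = {#d 1 - 2, d 2 - 2, d 3 - 2#}"
    by (drule_tac arg_cong[where f = "image_mset (\<lambda>t. t - 2)"]) simp
  then have "x + y + z = (d 1 - 2) + (d 2 - 2) + (d 3 - 2)"
    by (drule_tac arg_cong[where f = sum_mset]) (simp add: add_ac)
  note sum = this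
  moreover have "n = 5 + x + y + z" using card_verts I uvw(1) dist load by simp
  ultimately show "n + 1 = d 1 + d 2 + d 3" using d by linarith
  let ?f = "\<lambda>t. 2 ^ t :: nat"
  have "{#?f x, ?f y, ?f z#} = {#?f (d 1 - 2), ?f (d 2 - 2), ?f (d 3 - 2)#}"
    using arg_cong[OF mset, of "image_mset ?f"] by simp
  note min = weight3_min[OF this]
  have numT: "num_subtrees T = x + y + z + 2 + weight3 (2 ^ x) (2 ^ y) (2 ^ z)"
    by (rule num_subtrees_path3_weight[OF uvw(2,1) load])
  have numC: "num_subtrees C = x + y + z + 2
      + weight3 (2 ^ (d 1 - 2)) (2 ^ (d 3 - 2)) (2 ^ (d 2 - 2))"
    unfolding C num_subtrees_caterpillar3 using sum by simp
  show "num_subtrees C \<le> num_subtrees T" using min mono unfolding numT numC by simp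
  have "isomorphic T C" if "num_subtrees T = num_subtrees C"
  proof -
    \<comment> \<open>The linear parts of both counts agree, so the weights are equal; injectivity
      of powers of two then brings the equality of lists back to the exponents.\<close>
    have "[x, y, z] = [d 1 - 2, d 3 - 2, d 2 - 2] \<or> [x, y, z] = [d 2 - 2, d 3 - 2, d 1 - 2]"
      using min that mono unfolding numT numC by auto
    then consider "map load [u, v, w] = [d 1 - 2 + 1, d 3 - 2, d 2 - 2 + 1]"
      | "map load [w, v, u] = [d 1 - 2 + 1, d 3 - 2, d 2 - 2 + 1]" using load by auto
    then show ?thesis
    proof cases
      case 1
      have "cored_graph T (set [u, v, w]) par" using I(1) uvw(1) by simp
      then show ?thesis
        using 1 uvw cored_caterpillar3 path_core_caterpillar3 load_caterpillar3 unfolding C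
        by (intro path_core_isomorphic[of T "[u, v, w]" par _ "[Spine 1, Spine 2, Spine 3]" spine_parent]) auto
    next
      case 2
      have "cored_graph T (set [w, v, u]) par" using I(1) uvw(1) by (simp add: insert_commute)
      then show ?thesis
        using 2 uvw path_core_rev[OF uvw(2)] cored_caterpillar3 path_core_caterpillar3 load_caterpillar3
        unfolding C
        by (intro path_core_isomorphic[of T "[w, v, u]" par _ "[Spine 1, Spine 2, Spine 3]" spine_parent])
           (auto simp: insert_commute)
    qed
  qed
  moreover have "num_subtrees T = num_subtrees C" if "isomorphic T C"
    using cored_isomorphic_num_subtrees[OF I(1) cored_caterpillar3] that unfolding C by simp
  ultimately show "num_subtrees T = num_subtrees C \<longleftrightarrow> isomorphic T C" by blast
qed

text \<open>A path core is handled as for three vertices. For a star core the inequality is strict,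
  so the question of equality does not arise.\<close>

lemma four_internal:
  assumes T: "T \<in> trees_with_degrees n d" and n: "4 \<le> n"
    and core: "\<forall>i\<in>{1..4}. 2 \<le> d i" and leaves: "\<forall>i\<in>{4<..n}. d i = 1"
    and mono: "d 2 \<le> d 1" "d 3 \<le> d 2" "d 4 \<le> d 3"
    and C: "C = caterpillar [d 1 - 2, d 4 - 2, d 3 - 2, d 2 - 2]"
  shows "n + 2 = d 1 + d 2 + d 3 + d 4" "num_subtrees C \<le> num_subtrees T"
    "num_subtrees T = num_subtrees C \<longleftrightarrow> isomorphic T C"
proof -
  obtain I par where I: "cored_graph T I par" "connected_graph T" "card I = 4" "card (verts T) = n"
      "image_mset (degree T) (mset_set I) = image_mset d (mset_set {1..4})"
      "\<And>v. v \<in> I \<Longrightarrow> 2 \<le> degree T v"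
    by (rule degree_sequence_core[OF T _ n core leaves]) simp_all
  interpret cored_graph T I par by (fact I(1))
  have d: "2 \<le> d 1" "2 \<le> d 2" "2 \<le> d 3" "2 \<le> d 4" using core by auto
  have range: "{1..4::nat} = {1, 2, 3, 4}" by auto
  let ?f = "\<lambda>t. 2 ^ t :: nat"
  let ?y = "\<lambda>i. d i - 2"
  let ?S = "?y 1 + ?y 2 + ?y 3 + ?y 4"
  have numC: "num_subtrees C = ?S + 2 + weight4 (?f (?y 1)) (?f (?y 4)) (?f (?y 3)) (?f (?y 2))"
    unfolding C num_subtrees_caterpillar4 by simp
  have iso: "num_subtrees T = num_subtrees C" if "isomorphic T C"
    using cored_isomorphic_num_subtrees[OF I(1) cored_caterpillar4] that unfolding C by simp
  \<comment> \<open>Stated for any arrangement of the entries, because in the star case it is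
    applied to an auxiliary path that need not be the core of \<open>T\<close>.\<close>
  have min: "weight4 (?f (?y 1)) (?f (?y 4)) (?f (?y 3)) (?f (?y 2)) \<le> weight4 (?f p) (?f q) (?f r) (?f s)
      \<and> (weight4 (?f p) (?f q) (?f r) (?f s) = weight4 (?f (?y 1)) (?f (?y 4)) (?f (?y 3)) (?f (?y 2)) \<longrightarrow>
          [p, q, r, s] = [?y 1, ?y 4, ?y 3, ?y 2] \<or> [p, q, r, s] = [?y 2, ?y 3, ?y 4, ?y 1])"
    if "{#p, q, r, s#} = {#?y 1, ?y 2, ?y 3, ?y 4#}" for p q r s
  proof -
    have "{#?f p, ?f q, ?f r, ?f s#} = {#?f (?y 1), ?f (?y 2), ?f (?y 3), ?f (?y 4)#}"
      using arg_cong[OF that, of "image_mset ?f"] by simp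
    from weight4_min[OF this] show ?thesis using mono by simp
  qed
  have sum: "p + q + r + s = ?S" if "{#p, q, r, s#} = {#?y 1, ?y 2, ?y 3, ?y 4#}" for p q r s
    using arg_cong[OF that, of sum_mset] by (simp add: add_ac)
  from I(2,3) have "n + 2 = d 1 + d 2 + d 3 + d 4 \<and> num_subtrees C \<le> num_subtrees T \<and>
    (num_subtrees T = num_subtrees C \<longrightarrow> isomorphic T C)"
  proof (cases rule: core4_shape)
    case (1 t u v w)
    then have dist: "distinct [t, u, v, w]" by (simp add: path_core_def)
    define p q r s where "p = degree T t - 2" and "q = degree T u - 2" and "r = degree T v - 2"
      and "s = degree T w - 2"
    have "2 \<le> degree T t" "2 \<le> degree T u" "2 \<le> degree T v" "2 \<le> degree T w" using I(6) 1(1) by auto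
    then have deg: "degree T t = p + 2" "degree T u = q + 2" "degree T v = r + 2" "degree T w = s + 2"
      by (simp_all add: p_def q_def r_def s_def)
    then have load: "map load [t, u, v, w] = [p + 1, q, r, s + 1]" using degree_path4[OF 1(2,1)] by simp
    have "{#p + 2, q + 2, r + 2, s + 2#} = {#d 1, d 2, d 3, d 4#}" using I(5) 1(1) dist deg range by simp
    then have mset: "{#p, q, r, s#} = {#?y 1, ?y 2, ?y 3, ?y 4#}"
      by (drule_tac arg_cong[where f = "image_mset (\<lambda>t. t - 2)"]) simp
    have "n = 6 + p + q + r + s" using card_verts I 1(1) dist load by simp
    then have "n + 2 = d 1 + d 2 + d 3 + d 4" using d sum[OF mset] by linarith
    moreover have numT: "num_subtrees T = ?S + 2 + weight4 (?f p) (?f q) (?f r) (?f s)"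
      using num_subtrees_path4_weight[OF 1(2,1) load] sum[OF mset] by simp
    have "num_subtrees C \<le> num_subtrees T" using min[OF mset] unfolding numT numC by simp
    moreover have "isomorphic T C" if "num_subtrees T = num_subtrees C"
    proof -
      have "[p, q, r, s] = [?y 1, ?y 4, ?y 3, ?y 2] \<or> [p, q, r, s] = [?y 2, ?y 3, ?y 4, ?y 1]"
        using min[OF mset] that unfolding numT numC by auto
      then consider "map load [t, u, v, w] = [?y 1 + 1, ?y 4, ?y 3, ?y 2 + 1]"
        | "map load [w, v, u, t] = [?y 1 + 1, ?y 4, ?y 3, ?y 2 + 1]" using load by auto
      then show ?thesis
      proof cases
        case a: 1
        have "cored_graph T (set [t, u, v, w]) par" using I(1) 1(1) by simp
        then show ?thesis
          using a 1 cored_caterpillar4 path_core_caterpillar4 load_caterpillar4 unfolding C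
          by (intro path_core_isomorphic[of T "[t, u, v, w]" par _
                "[Spine 1, Spine 2, Spine 3, Spine 4]" spine_parent]) auto
      next
        case a: 2
        have "cored_graph T (set [w, v, u, t]) par" using I(1) 1(1) by (simp add: insert_commute)
        then show ?thesis
          using a 1 path_core_rev[OF 1(2)] cored_caterpillar4 path_core_caterpillar4 load_caterpillar4
          unfolding C
          by (intro path_core_isomorphic[of T "[w, v, u, t]" par _
                "[Spine 1, Spine 2, Spine 3, Spine 4]" spine_parent]) (auto simp: insert_commute)
      qed
    qed
    ultimately show ?thesis by blast
  next
    case (2 t u v w)
    then have dist: "distinct [t, u, v, w]" by (simp add: star_core_def)
    define c p q r where "c = load t" and "p = degree T u - 2" and "q = degree T v - 2"
      and "r = degree T w - 2"
    have "2 \<le> degree T u" "2 \<le> degree T v" "2 \<le> degree T w" using I(6) 2(1) by auto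
    then have deg: "degree T t = c + 3" "degree T u = p + 2" "degree T v = q + 2" "degree T w = r + 2"
      using degree_star4[OF 2(2,1)] by (simp_all add: c_def p_def q_def r_def)
    then have load: "map load [t, u, v, w] = [c, p + 1, q + 1, r + 1]" using degree_star4[OF 2(2,1)] by simp
    have "{#c + 3, p + 2, q + 2, r + 2#} = {#d 1, d 2, d 3, d 4#}" using I(5) 2(1) dist deg range by simp
    \<comment> \<open>The centre has three core neighbours, so its degree minus two is
      \<open>c + 1\<close>, one more than its load.\<close>
    then have mset: "{#c + 1, p, q, r#} = {#?y 1, ?y 2, ?y 3, ?y 4#}"
      by (drule_tac arg_cong[where f = "image_mset (\<lambda>t. t - 2)"]) simp
    have "n = 7 + c + p + q + r" using card_verts I 2(1) dist load by simp
    then have "n + 2 = d 1 + d 2 + d 3 + d 4" using d sum[OF mset] by linarith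
    moreover have numT: "num_subtrees T = ?S + 2 + (2 * ?f p + 2 * ?f q + 2 * ?f r
        + ?f c * (1 + 2 * ?f p) * (1 + 2 * ?f q) * (1 + 2 * ?f r))"
      using num_subtrees_star4_weight[OF 2(2,1) load] sum[OF mset] by simp
    have "weight4 (?f (?y 1)) (?f (?y 4)) (?f (?y 3)) (?f (?y 2)) < 2 * ?f p + 2 * ?f q + 2 * ?f r
        + ?f c * (1 + 2 * ?f p) * (1 + 2 * ?f q) * (1 + 2 * ?f r)" (is "_ < ?star")
    \<comment> \<open>The outer vertices of the star are interchangeable. The larger of
      \<open>p\<close> and \<open>q\<close> becomes the end next to the centre in the comparison
      path, as \<open>star_weight_gt\<close> requires.\<close>
    proof (cases "q \<le> p")
      case True
      have "weight4 (?f p) (?f (c + 1)) (?f q) (?f r) < ?star"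
        using star_weight_gt[of "?f q" "?f p" "?f c" "?f r"] True by simp
      moreover have "{#p, c + 1, q, r#} = {#?y 1, ?y 2, ?y 3, ?y 4#}"
        using mset by (simp add: add_mset_commute)
      ultimately show ?thesis using min[of p "c + 1" q r] by linarith
    next
      case False
      have "weight4 (?f q) (?f (c + 1)) (?f p) (?f r) < ?star"
        using star_weight_gt[of "?f p" "?f q" "?f c" "?f r"] False by (simp add: algebra_simps)
      moreover have "{#q, c + 1, p, r#} = {#?y 1, ?y 2, ?y 3, ?y 4#}"
        using mset by (simp add: add_mset_commute)
      ultimately show ?thesis using min[of q "c + 1" p r] by linarith
    qed
    then have "num_subtrees C < num_subtrees T" unfolding numT numC by linarith
    ultimately show ?thesis by simp
  qed
  then show "n + 2 = d 1 + d 2 + d 3 + d 4" "num_subtrees C \<le> num_subtrees T"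
    "num_subtrees T = num_subtrees C \<longleftrightarrow> isomorphic T C"
    using iso by blast+
qed

theorem theorem4p1:
  fixes n k :: nat and d :: "nat \<Rightarrow> nat"
  assumes k_range: "2 \<le> k" "k \<le> 4"
    and k_le_n: "k \<le> n"
    and decreasing: "\<And>i j. 1 \<le> i \<Longrightarrow> i \<le> j \<Longrightarrow> j \<le> k \<Longrightarrow> d j \<le> d i"
    and internal: "2 \<le> d k"
    and leaves: "\<And>i. k < i \<Longrightarrow> i \<le> n \<Longrightarrow> d i = 1"
    and tree_sequence: "(trees_with_degrees n d :: 'a ugraph set) \<noteq> {}"
  shows
    "(k = 2 \<longrightarrow>
        (\<forall>T \<in> (trees_with_degrees n d :: 'a ugraph set).
           num_subtrees T = 2 ^ (n - 2) + 2 ^ (d 1 - 1) + 2 ^ (d 2 - 1) + n - 2)) \<and>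
     (k = 3 \<longrightarrow>
        (let C = caterpillar [d 1 - 2, d 3 - 2, d 2 - 2] in
           num_subtrees C =
             (n - 3) + 2 ^ (d 1 - 1) + 2 ^ (d 2 - 1) + 2 ^ (d 3 - 2)
             + 2 ^ (d 1 + d 3 - 3) + 2 ^ (d 3 + d 2 - 3) + 2 ^ (n - 3) \<and>
           (\<forall>T \<in> (trees_with_degrees n d :: 'a ugraph set).
              num_subtrees T \<ge> num_subtrees C \<and>
              (num_subtrees T = num_subtrees C \<longleftrightarrow> isomorphic T C)))) \<and>
     (k = 4 \<longrightarrow>
        (let C = caterpillar [d 1 - 2, d 4 - 2, d 3 - 2, d 2 - 2] in
           num_subtrees C =
             (n - 4) + 2 ^ (d 1 - 1) + 2 ^ (d 2 - 1) + 2 ^ (d 3 - 2) + 2 ^ (d 4 - 2)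
             + 2 ^ (d 1 + d 4 - 3) + 2 ^ (d 3 + d 4 - 4) + 2 ^ (d 3 + d 2 - 3)
             + 2 ^ (d 1 + d 4 + d 3 - 5) + 2 ^ (d 2 + d 3 + d 4 - 5) + 2 ^ (n - 4) \<and>
           (\<forall>T \<in> (trees_with_degrees n d :: 'a ugraph set).
              num_subtrees T \<ge> num_subtrees C \<and>
              (num_subtrees T = num_subtrees C \<longleftrightarrow> isomorphic T C))))"
proof -
  have core: "\<forall>i\<in>{1..k}. 2 \<le> d i" using decreasing internal by (meson atLeastAtMost_iff order_refl order_trans)
  have leaf: "\<forall>i\<in>{k<..n}. d i = 1" using leaves by simp
  \<comment> \<open>A tree realizing the sequence ties \<open>n\<close> to the sum of the internal
    degrees, which the formulas for the caterpillars require.\<close>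
  obtain T0 :: "'a ugraph" where T0: "T0 \<in> trees_with_degrees n d" using tree_sequence by blast
  have "num_subtrees T = 2 ^ (n - 2) + 2 ^ (d 1 - 1) + 2 ^ (d 2 - 1) + n - 2"
    if "k = 2" "T \<in> trees_with_degrees n d" for T :: "'a ugraph"
    using two_internal[OF that(2)] k_le_n core leaf that(1) by simp
  moreover have "let C = caterpillar [d 1 - 2, d 3 - 2, d 2 - 2] in
      num_subtrees C =
        (n - 3) + 2 ^ (d 1 - 1) + 2 ^ (d 2 - 1) + 2 ^ (d 3 - 2)
        + 2 ^ (d 1 + d 3 - 3) + 2 ^ (d 3 + d 2 - 3) + 2 ^ (n - 3) \<and>
      (\<forall>T \<in> (trees_with_degrees n d :: 'a ugraph set).
         num_subtrees T \<ge> num_subtrees C \<and>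
         (num_subtrees T = num_subtrees C \<longleftrightarrow> isomorphic T C))" if k: "k = 3"
  proof -
    have mono: "d 2 \<le> d 1" "d 3 \<le> d 2" using decreasing k by auto
    note three = three_internal[OF _ k_le_n[unfolded k] core[unfolded k] leaf[unfolded k] mono refl]
    have "2 \<le> d 1" "2 \<le> d 2" "2 \<le> d 3" using core k by auto
    \<comment> \<open>Writing each degree as \<open>y + 2\<close> removes the truncated subtractions
      from the exponents before the polynomial identity is checked.\<close>
    then obtain y1 y2 y3 where y: "d 1 = y1 + 2" "d 2 = y2 + 2" "d 3 = y3 + 2"
      by (metis le_add_diff_inverse2)
    have "n = y1 + y2 + y3 + 5" using three(1)[OF T0] y by simp
    then have "num_subtrees (caterpillar [d 1 - 2, d 3 - 2, d 2 - 2]) =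
        (n - 3) + 2 ^ (d 1 - 1) + 2 ^ (d 2 - 1) + 2 ^ (d 3 - 2)
        + 2 ^ (d 1 + d 3 - 3) + 2 ^ (d 3 + d 2 - 3) + 2 ^ (n - 3)"
      unfolding y by (simp add: num_subtrees_caterpillar3 weight3_def power_add algebra_simps)
    then show ?thesis unfolding Let_def using three(2,3) by blast
  qed
  moreover have "let C = caterpillar [d 1 - 2, d 4 - 2, d 3 - 2, d 2 - 2] in
      num_subtrees C =
        (n - 4) + 2 ^ (d 1 - 1) + 2 ^ (d 2 - 1) + 2 ^ (d 3 - 2) + 2 ^ (d 4 - 2)
        + 2 ^ (d 1 + d 4 - 3) + 2 ^ (d 3 + d 4 - 4) + 2 ^ (d 3 + d 2 - 3)
        + 2 ^ (d 1 + d 4 + d 3 - 5) + 2 ^ (d 2 + d 3 + d 4 - 5) + 2 ^ (n - 4) \<and>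
      (\<forall>T \<in> (trees_with_degrees n d :: 'a ugraph set).
         num_subtrees T \<ge> num_subtrees C \<and>
         (num_subtrees T = num_subtrees C \<longleftrightarrow> isomorphic T C))" if k: "k = 4"
  proof -
    have mono: "d 2 \<le> d 1" "d 3 \<le> d 2" "d 4 \<le> d 3" using decreasing k by auto
    note four = four_internal[OF _ k_le_n[unfolded k] core[unfolded k] leaf[unfolded k] mono refl]
    have "2 \<le> d 1" "2 \<le> d 2" "2 \<le> d 3" "2 \<le> d 4" using core k by auto
    then obtain y1 y2 y3 y4 where y: "d 1 = y1 + 2" "d 2 = y2 + 2" "d 3 = y3 + 2" "d 4 = y4 + 2"
      by (metis le_add_diff_inverse2)
    have "n = y1 + y2 + y3 + y4 + 6" using four(1)[OF T0] y by simp
    then have "num_subtrees (caterpillar [d 1 - 2, d 4 - 2, d 3 - 2, d 2 - 2]) =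
        (n - 4) + 2 ^ (d 1 - 1) + 2 ^ (d 2 - 1) + 2 ^ (d 3 - 2) + 2 ^ (d 4 - 2)
        + 2 ^ (d 1 + d 4 - 3) + 2 ^ (d 3 + d 4 - 4) + 2 ^ (d 3 + d 2 - 3)
        + 2 ^ (d 1 + d 4 + d 3 - 5) + 2 ^ (d 2 + d 3 + d 4 - 5) + 2 ^ (n - 4)"
      unfolding y by (simp add: num_subtrees_caterpillar4 weight4_def power_add algebra_simps)
    then show ?thesis unfolding Let_def using four(2,3) by blast
  qed
  ultimately show ?thesis by blast
qed

end
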